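(* Let $k$ be an odd prime and $\lambda$ a partition. Suppose that $m_{\lambda,\nu}=\delta_{\lambda,\nu}$ for all partitions $\nu$ of $|\lambda|$ (equivalently, $\mathfrak s^{(k)}_\lambda=s_\lambda$). Then $\lambda$ is a $k$-core.
   Context: The Petrie symmetric functions $G(k,m)$ are defined by $\sum_{m\ge0}G(k,m)(X)z^m=\prod_{i\ge1}\sum_{j=0}^{k-1}(x_iz)^j$, with $G(k,m)=0$ for $m<0$. The modular Schur function is $\mathfrak s^{(k)}_\lambda(X)=\det_{1\le i,j\le\ell(\lambda)}\bigl(G(k,\lambda_i-i+j)(X)\bigr)$, and the coefficients $m_{\lambda,\nu}$ are defined by $\mathfrak s^{(k)}_\lambda=\sum_{\nu\vdash|\lambda|}m_{\lambda,\nu}\,s_\nu$, where $s_\nu$ are the Schur functions. A partition is a $k$-core if no ribbon with $k$ boxes can be removed from it; equivalently none of its hook lengths is divisible by $k$. *)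

theory Defs
  imports
    "HOL-Library.Poly_Mapping"
    "HOL-Computational_Algebra.Formal_Power_Series"
    "HOL-Computational_Algebra.Primes"
    "Jordan_Normal_Form.Determinant"
begin

section \<open>Formal power series in countably many variables\<close>

text \<open>
  A monomial in the variables \<open>x\<^sub>0, x\<^sub>1, \<dots>\<close> is a finitely supported exponent function
  of type \<^typ>\<open>nat \<Rightarrow>\<^sub>0 nat\<close>; a series assigns a coefficient to every monomial.  The ring of symmetric
  functions is a subring of this ring.
\<close>

typedef 'a mseries = "UNIV :: ((nat \<Rightarrow>\<^sub>0 nat) \<Rightarrow> 'a) set"
  morphisms mcoeff MSeries ..

setup_lifting type_definition_mseries

lemma mseries_eqI: "(\<And>a. mcoeff f a = mcoeff g a) \<Longrightarrow> f = g"
  by (metis mcoeff_inject ext)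

lemma finite_monomial_splits: "finite {(b, c). b + c = (a :: nat \<Rightarrow>\<^sub>0 nat)}"
proof -
  let ?B = "{b :: nat \<Rightarrow>\<^sub>0 nat. \<exists>c. b + c = a}"
  let ?M = "Max (insert 0 (Poly_Mapping.lookup a ` Poly_Mapping.keys a))"
  have le: "Poly_Mapping.lookup a i \<le> ?M" for i
  proof (cases "i \<in> Poly_Mapping.keys a")
    case True
    then show ?thesis by (intro Max_ge) auto
  qed (simp add: in_keys_iff)
  have "Poly_Mapping.lookup ` ?B \<subseteq> {f. \<forall>i. (i \<in> Poly_Mapping.keys a \<longrightarrow> f i \<in> {..?M}) \<and>
      (i \<notin> Poly_Mapping.keys a \<longrightarrow> f i = 0)}"
  proof clarify
    fix b c i assume "a = b + (c :: nat \<Rightarrow>\<^sub>0 nat)"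
    then have "Poly_Mapping.lookup a i = Poly_Mapping.lookup b i + Poly_Mapping.lookup c i"
      by (simp add: lookup_add)
    then show "(i \<in> Poly_Mapping.keys (b + c) \<longrightarrow>
          Poly_Mapping.lookup b i \<in> {..Max (insert 0 (Poly_Mapping.lookup (b + c) ` Poly_Mapping.keys (b + c)))})
        \<and> (i \<notin> Poly_Mapping.keys (b + c) \<longrightarrow> Poly_Mapping.lookup b i = 0)"
      using le[of i] \<open>a = b + c\<close> by (auto simp: in_keys_iff)
  qed
  then have "finite (Poly_Mapping.lookup ` ?B)"
    by (rule finite_subset) (rule finite_set_of_finite_funs, auto)
  then have fin: "finite ?B"
    by (rule finite_imageD) (simp add: inj_on_def poly_mapping_eqI)
  have "\<exists>b. b + c = a" if "b + c = a" for b c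
    using that by blast
  moreover have "\<exists>c. c + b = a" if "b + c = a" for b c
    using that by (metis add.commute)
  ultimately have "{(b, c). b + c = a} \<subseteq> ?B \<times> ?B"
    by (auto simp: add.commute)
  then show ?thesis
    by (rule finite_subset) (use fin in auto)
qed

lemma finite_monomial_splits': "finite {p. fst p + snd p = (a :: nat \<Rightarrow>\<^sub>0 nat)}"
  using finite_monomial_splits[of a] by (simp add: case_prod_unfold)

instantiation mseries :: (comm_ring_1) comm_ring_1
begin

lift_definition zero_mseries :: "'a mseries" is "\<lambda>_. 0" .
lift_definition one_mseries :: "'a mseries" is "\<lambda>a. if a = 0 then 1 else 0" .
lift_definition plus_mseries :: "'a mseries \<Rightarrow> 'a mseries \<Rightarrow> 'a mseries"
  is "\<lambda>f g a. f a + g a" .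
lift_definition minus_mseries :: "'a mseries \<Rightarrow> 'a mseries \<Rightarrow> 'a mseries"
  is "\<lambda>f g a. f a - g a" .
lift_definition uminus_mseries :: "'a mseries \<Rightarrow> 'a mseries"
  is "\<lambda>f a. - f a" .
lift_definition times_mseries :: "'a mseries \<Rightarrow> 'a mseries \<Rightarrow> 'a mseries"
  is "\<lambda>f g a. \<Sum>(b, c) \<in> {(b, c). b + c = a}. f b * g c" .

instance
proof
  fix f g h :: "'a mseries"
  show "f + g + h = f + (g + h)" "f + g = g + f" "0 + f = f" "- f + f = 0" "f - g = f + - g"
    by (transfer, auto simp: algebra_simps)+
  show "f * g * h = f * (g * h)"
  proof (transfer, rule ext)
    fix f g h :: "(nat \<Rightarrow>\<^sub>0 nat) \<Rightarrow> 'a" and a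
    have "(\<Sum>(b, c)\<in>{(b, c). b + c = a}. (\<Sum>(d, e)\<in>{(d, e). d + e = b}. f d * g e) * h c)
        = (\<Sum>((b, c), (d, e))\<in>(SIGMA p:{(b, c). b + c = a}. {(d, e). d + e = fst p}).
              f d * g e * h c)"
      by (subst sum.Sigma[symmetric])
         (auto simp: finite_monomial_splits' sum_distrib_right case_prod_unfold)
    also have "\<dots> = (\<Sum>((b, c), (d, e))\<in>(SIGMA p:{(b, c). b + c = a}. {(d, e). d + e = snd p}).
              f b * (g d * h e))"
      by (rule sum.reindex_bij_witness
            [where i = "\<lambda>((b, c), (d, e)). ((b + d, e), (b, d))"
               and j = "\<lambda>((b, c), (d, e)). ((d, e + c), (e, c))"])
         (auto simp: algebra_simps)
    also have "\<dots> = (\<Sum>(b, c)\<in>{(b, c). b + c = a}. f b * (\<Sum>(d, e)\<in>{(d, e). d + e = c}. g d * h e))"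
      by (subst sum.Sigma[symmetric])
         (auto simp: finite_monomial_splits' sum_distrib_left case_prod_unfold)
    finally show "(\<Sum>(b, c)\<in>{(b, c). b + c = a}. (\<Sum>(d, e)\<in>{(d, e). d + e = b}. f d * g e) * h c)
        = (\<Sum>(b, c)\<in>{(b, c). b + c = a}. f b * (\<Sum>(d, e)\<in>{(d, e). d + e = c}. g d * h e))" .
  qed
  show "f * g = g * f"
    by (transfer, rule ext, rule sum.reindex_bij_witness[where i = prod.swap and j = prod.swap])
       (auto simp: algebra_simps)
  show "1 * f = f"
  proof (transfer, rule ext)
    fix f :: "(nat \<Rightarrow>\<^sub>0 nat) \<Rightarrow> 'a" and a
    have "(\<Sum>(b, c)\<in>{(b, c). b + c = a}. (if b = 0 then 1 else 0) * f c)
        = (\<Sum>(b, c)\<in>{(0 :: nat \<Rightarrow>\<^sub>0 nat, a)}. (if b = 0 then 1 else 0) * f c)"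
      by (rule sum.mono_neutral_right) (auto simp: finite_monomial_splits split: if_splits)
    then show "(\<Sum>(b, c)\<in>{(b, c). b + c = a}. (if b = 0 then 1 else 0) * f c) = f a"
      by simp
  qed
  show "(f + g) * h = f * h + g * h"
    by (transfer, rule ext) (simp add: case_prod_unfold sum.distrib distrib_right)
  show "(0 :: 'a mseries) \<noteq> 1"
    by transfer (metis zero_neq_one)
qed

end

lift_definition mvar :: "nat \<Rightarrow> 'a::comm_ring_1 mseries"
  is "\<lambda>i a. if a = Poly_Mapping.single i 1 then 1 else 0" .


section \<open>Partitions and Young diagrams\<close>

definition is_partition :: "nat list \<Rightarrow> bool" where
  "is_partition lam \<longleftrightarrow> sorted_wrt (\<ge>) lam \<and> 0 \<notin> set lam"

definition partitions :: "nat \<Rightarrow> nat list set" where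
  "partitions n = {nu. is_partition nu \<and> sum_list nu = n}"

lemma finite_partitions: "finite (partitions n)"
proof (rule finite_subset)
  show "partitions n \<subseteq> {xs. set xs \<subseteq> {..n} \<and> length xs \<le> n}"
  proof
    fix nu assume "nu \<in> partitions n"
    then have nz: "0 \<notin> set nu" and n: "n = sum_list nu"
      by (auto simp: partitions_def is_partition_def)
    have "length nu \<le> sum_list nu"
      using nz by (induction nu) auto
    then show "nu \<in> {xs. set xs \<subseteq> {..n} \<and> length xs \<le> n}"
      by (auto simp: n member_le_sum_list)
  qed
qed (simp add: finite_lists_length_le)

text \<open>Rows and columns are numbered from 0.\<close>

definition diagram :: "nat list \<Rightarrow> (nat \<times> nat) set" where
  "diagram lam = {(i, j). i < length lam \<and> j < lam ! i}"

lemma finite_diagram: "finite (diagram lam)"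
proof (rule finite_subset)
  show "diagram lam \<subseteq> (SIGMA i:{..<length lam}. {..<lam ! i})"
    by (auto simp: diagram_def)
qed simp

definition adjacent_in :: "(nat \<times> nat) set \<Rightarrow> ((nat \<times> nat) \<times> (nat \<times> nat)) set" where
  "adjacent_in S = {((i, j), (i', j')). (i, j) \<in> S \<and> (i', j') \<in> S \<and>
     (i = i' \<and> (j' = Suc j \<or> j = Suc j') \<or> j = j' \<and> (i' = Suc i \<or> i = Suc i'))}"

text \<open>
  A ribbon is a nonempty connected skew diagram without 2-by-2 squares; the predicate is only applied to
  skew diagrams.
\<close>

definition is_ribbon :: "(nat \<times> nat) set \<Rightarrow> bool" where
  "is_ribbon S \<longleftrightarrow> S \<noteq> {} \<and> (\<forall>c\<in>S. \<forall>d\<in>S. (c, d) \<in> (adjacent_in S)\<^sup>*) \<and>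
     \<not> (\<exists>i j. {(i, j), (Suc i, j), (i, Suc j), (Suc i, Suc j)} \<subseteq> S)"

definition is_core :: "nat \<Rightarrow> nat list \<Rightarrow> bool" where
  "is_core k lam \<longleftrightarrow> \<not> (\<exists>mu. is_partition mu \<and> diagram mu \<subseteq> diagram lam \<and>
     is_ribbon (diagram lam - diagram mu) \<and> card (diagram lam - diagram mu) = k)"


section \<open>Schur functions, Petrie symmetric functions and modular Schur functions\<close>

text \<open>
  Entries of tableaux are natural numbers, 0 included, matching the numbering of the variables.
  Fillings are set to 0 outside the diagram so that each tableau is represented once.
\<close>

definition ssyt :: "nat list \<Rightarrow> (nat \<times> nat \<Rightarrow> nat) set" where
  "ssyt lam = {T.
     (\<forall>c. c \<notin> diagram lam \<longrightarrow> T c = 0) \<and>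
     (\<forall>i j. (i, Suc j) \<in> diagram lam \<longrightarrow> T (i, j) \<le> T (i, Suc j)) \<and>
     (\<forall>i j. (Suc i, j) \<in> diagram lam \<longrightarrow> T (i, j) < T (Suc i, j))}"

definition tableau_weight :: "nat list \<Rightarrow> (nat \<times> nat \<Rightarrow> nat) \<Rightarrow> (nat \<Rightarrow>\<^sub>0 nat)" where
  "tableau_weight lam T = (\<Sum>c\<in>diagram lam. Poly_Mapping.single (T c) 1)"

lemma finite_tableaux_of_weight: "finite {T \<in> ssyt lam. tableau_weight lam T = a}"
proof (rule finite_subset)
  show "{T \<in> ssyt lam. tableau_weight lam T = a} \<subseteq>
      {T. \<forall>c. (c \<in> diagram lam \<longrightarrow> T c \<in> Poly_Mapping.keys a) \<and> (c \<notin> diagram lam \<longrightarrow> T c = 0)}"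
  proof clarify
    fix T c assume T: "T \<in> ssyt lam"
    have "T c \<in> Poly_Mapping.keys (tableau_weight lam T)" if c: "c \<in> diagram lam"
    proof -
      have "Poly_Mapping.lookup (tableau_weight lam T) (T c) =
          1 + (\<Sum>d\<in>diagram lam - {c}. Poly_Mapping.lookup (Poly_Mapping.single (T d) 1) (T c))"
        unfolding tableau_weight_def lookup_sum
        by (subst sum.remove[OF finite_diagram c]) simp
      then show ?thesis by (simp add: in_keys_iff)
    qed
    then show "(c \<in> diagram lam \<longrightarrow> T c \<in> Poly_Mapping.keys (tableau_weight lam T)) \<and>
        (c \<notin> diagram lam \<longrightarrow> T c = 0)"
      using T by (cases c) (simp add: ssyt_def)
  qed
qed (intro finite_set_of_finite_funs finite_diagram finite_keys)

text \<open>The sum of the monomials \<open>x\<^sup>T\<close> over all semistandard tableaux \<open>T\<close>, coefficient by coefficient.\<close>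

definition schur :: "nat list \<Rightarrow> int mseries" where
  "schur lam = MSeries (\<lambda>a. int (card {T \<in> ssyt lam. tableau_weight lam T = a}))"

definition petrie_factor :: "nat \<Rightarrow> nat \<Rightarrow> int mseries fps" where
  "petrie_factor k i = (\<Sum>j<k. (fps_const (mvar i) * fps_X) ^ j)"

lemma mcoeff_mvar_pow_mult:
  "mcoeff (mvar i ^ j * f) a =
     (if j \<le> Poly_Mapping.lookup a i then mcoeff f (a - Poly_Mapping.single i j) else 0)"
proof (induction j arbitrary: a)
  case 0
  then show ?case by simp
next
  case (Suc j)
  have split: "b + c = a \<longleftrightarrow> c = a - b \<and> 1 \<le> Poly_Mapping.lookup a i"
    if "b = Poly_Mapping.single i 1" for b c a :: "nat \<Rightarrow>\<^sub>0 nat"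
  proof
    assume "c = a - b \<and> 1 \<le> Poly_Mapping.lookup a i"
    then show "b + c = a"
      using that by (intro poly_mapping_eqI) (auto simp: lookup_add lookup_minus lookup_single when_def)
  next
    assume "b + c = a"
    then show "c = a - b \<and> 1 \<le> Poly_Mapping.lookup a i"
      using that by (auto simp: lookup_add)
  qed
  have step: "mcoeff (mvar i * g) a =
      (if 1 \<le> Poly_Mapping.lookup a i then mcoeff g (a - Poly_Mapping.single i 1) else 0)"
    for g :: "'a mseries" and a
  proof -
    let ?b = "Poly_Mapping.single i (1::nat)"
    have "mcoeff (mvar i * g) a =
        (\<Sum>(b, c)\<in>{(b, c). b + c = a}. (if b = ?b then 1 else 0) * mcoeff g c)"
      by (simp add: times_mseries.rep_eq mvar.rep_eq)
    also have "\<dots> = (\<Sum>(b, c)\<in>{(b, c). b = ?b \<and> b + c = a}. mcoeff g c)"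
      by (rule sum.mono_neutral_cong_right) (auto simp: finite_monomial_splits' case_prod_unfold
        split: if_splits)
    also have "{(b, c). b = ?b \<and> b + c = a} = (if 1 \<le> Poly_Mapping.lookup a i then {(?b, a - ?b)} else {})"
      using split[OF refl] by auto
    finally show ?thesis by simp
  qed
  have "a - Poly_Mapping.single i 1 - Poly_Mapping.single i j = a - Poly_Mapping.single i (Suc j)"
    by (intro poly_mapping_eqI) (auto simp: lookup_minus lookup_single when_def)
  then show ?case
    by (auto simp: mult.assoc step Suc.IH lookup_minus)
qed

lemma mcoeff_sum: "mcoeff (sum f A) a = (\<Sum>x\<in>A. mcoeff (f x) a)"
  by (induction A rule: infinite_finite_induct)
     (auto simp: zero_mseries.rep_eq plus_mseries.rep_eq)

lemma petrie_partial_coeff: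
  assumes "k > 0"
  shows "mcoeff (fps_nth (\<Prod>i<n. petrie_factor k i) m) a =
     (if Poly_Mapping.keys a \<subseteq> {..<n} \<and>
         (\<Sum>i\<in>Poly_Mapping.keys a. Poly_Mapping.lookup a i) = m \<and>
         (\<forall>i\<in>Poly_Mapping.keys a. Poly_Mapping.lookup a i < k)
      then 1 else 0)"
proof (induction n arbitrary: m a)
  case 0
  then show ?case by (auto simp: one_mseries.rep_eq zero_mseries.rep_eq)
next
  case (Suc n)
  let ?P = "\<Prod>i<n. petrie_factor k i"
  let ?r = "a - Poly_Mapping.single n (Poly_Mapping.lookup a n)"
  have "petrie_factor k n * ?P =
      (\<Sum>j<k. fps_X ^ j * (fps_const (mvar n ^ j) * ?P))"
    by (simp add: petrie_factor_def sum_distrib_right sum_distrib_left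
          power_mult_distrib fps_const_power mult_ac)
  then have "mcoeff (fps_nth (petrie_factor k n * ?P) m) a =
      (\<Sum>j<k. if m < j then 0 else mcoeff (mvar n ^ j * fps_nth ?P (m - j)) a)"
    by (auto simp: fps_sum_nth mcoeff_sum fps_X_power_mult_nth zero_mseries.rep_eq
          intro!: sum.cong)
  also have "\<dots> = (\<Sum>j<k. if j = Poly_Mapping.lookup a n then
      if j \<le> m then mcoeff (fps_nth ?P (m - j)) ?r else 0 else 0)"
  proof (rule sum.cong[OF refl])
    fix j
    have "n \<in> Poly_Mapping.keys (a - Poly_Mapping.single n j)" if "j < Poly_Mapping.lookup a n"
      using that by (simp add: in_keys_iff lookup_minus)
    then have "\<not> Poly_Mapping.keys (a - Poly_Mapping.single n j) \<subseteq> {..<n}"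
      if "j < Poly_Mapping.lookup a n" using that by blast
    then have "j = Poly_Mapping.lookup a n"
      if "Poly_Mapping.keys (a - Poly_Mapping.single n j) \<subseteq> {..<n}"
         "j \<le> Poly_Mapping.lookup a n"
      using that le_neq_implies_less by blast
    then show "(if m < j then 0 else mcoeff (mvar n ^ j * fps_nth ?P (m - j)) a) =
       (if j = Poly_Mapping.lookup a n then
          if j \<le> m then mcoeff (fps_nth ?P (m - j)) ?r else 0 else 0)"
      by (auto simp: mcoeff_mvar_pow_mult Suc.IH)
  qed
  also have "\<dots> = (if Poly_Mapping.lookup a n < k \<and> Poly_Mapping.lookup a n \<le> m
      then mcoeff (fps_nth ?P (m - Poly_Mapping.lookup a n)) ?r else 0)"
    by auto
  also have "\<dots> = (if Poly_Mapping.keys a \<subseteq> {..<Suc n} \<and>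
      (\<Sum>i\<in>Poly_Mapping.keys a. Poly_Mapping.lookup a i) = m \<and>
      (\<forall>i\<in>Poly_Mapping.keys a. Poly_Mapping.lookup a i < k) then 1 else 0)"
  proof -
    have look: "Poly_Mapping.lookup ?r i = (if i = n then 0 else Poly_Mapping.lookup a i)" for i
      by (simp add: lookup_minus lookup_single when_def)
    have keys: "Poly_Mapping.keys ?r = Poly_Mapping.keys a - {n}"
      by (auto simp: in_keys_iff look split: if_splits)
    have sum: "(\<Sum>i\<in>Poly_Mapping.keys a. Poly_Mapping.lookup a i) =
        Poly_Mapping.lookup a n + (\<Sum>i\<in>Poly_Mapping.keys ?r. Poly_Mapping.lookup ?r i)"
    proof (cases "n \<in> Poly_Mapping.keys a")
      case True
      then show ?thesis
        unfolding keys by (subst sum.remove[of _ n]) (auto simp: look)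
    next
      case False
      then show ?thesis
        unfolding keys by (auto simp: look in_keys_iff intro!: sum.cong)
    qed
    have sub: "Poly_Mapping.keys ?r \<subseteq> {..<n} \<longleftrightarrow> Poly_Mapping.keys a \<subseteq> {..<Suc n}"
      unfolding keys by (auto simp: less_Suc_eq)
    have bd: "(\<forall>i\<in>Poly_Mapping.keys a. Poly_Mapping.lookup a i < k) \<longleftrightarrow>
        (\<forall>i\<in>Poly_Mapping.keys ?r. Poly_Mapping.lookup ?r i < k)"
      if "Poly_Mapping.lookup a n < k"
      using that unfolding keys by (auto simp: look)
    show ?thesis
    proof (cases "Poly_Mapping.lookup a n < k")
      case True
      show ?thesis
        unfolding Suc.IH sub sum bd[OF True] using True
        by (cases "Poly_Mapping.lookup a n \<le> m") auto
    next
      case False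
      then have "n \<in> Poly_Mapping.keys a"
        using assms by (auto simp: in_keys_iff)
      then have "\<not> (\<forall>i\<in>Poly_Mapping.keys a. Poly_Mapping.lookup a i < k)"
        using False by blast
      with False show ?thesis by simp
    qed
  qed
  finally show ?case by (simp add: mult.commute)
qed

text \<open>
  The infinite product over all variables is the coefficientwise limit of the finite products; each
  coefficient is eventually constant, see \<open>petrie_coeff\<close> below.
\<close>

definition petrie :: "nat \<Rightarrow> int \<Rightarrow> int mseries" where
  "petrie k m = (if m < 0 then 0
     else MSeries (\<lambda>a. lim (\<lambda>n. mcoeff (fps_nth (\<Prod>i<n. petrie_factor k i) (nat m)) a)))"

lemma petrie_coeff:
  assumes "k > 0"
  shows "mcoeff (petrie k m) a =
    (if int (\<Sum>i\<in>Poly_Mapping.keys a. Poly_Mapping.lookup a i) = m \<and>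
        (\<forall>i\<in>Poly_Mapping.keys a. Poly_Mapping.lookup a i < k) then 1 else 0)"
proof (cases "m < 0")
  case True
  then show ?thesis
    by (simp add: petrie_def zero_mseries.rep_eq sum_nonneg del: of_nat_sum)
next
  case False
  let ?c = "if (\<Sum>i\<in>Poly_Mapping.keys a. Poly_Mapping.lookup a i) = nat m \<and>
      (\<forall>i\<in>Poly_Mapping.keys a. Poly_Mapping.lookup a i < k) then 1 else (0::int)"
  obtain N where N: "Poly_Mapping.keys a \<subseteq> {..<N}"
    using finite_nat_set_iff_bounded[of "Poly_Mapping.keys a"] by auto
  have "eventually (\<lambda>n. mcoeff (fps_nth (\<Prod>i<n. petrie_factor k i) (nat m)) a = ?c) sequentially"
    by (rule eventually_sequentiallyI[of N]) (use N in \<open>auto simp: petrie_partial_coeff[OF assms]\<close>)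
  then have "(\<lambda>n. mcoeff (fps_nth (\<Prod>i<n. petrie_factor k i) (nat m)) a) \<longlonglongrightarrow> ?c"
    by (rule tendsto_eventually)
  then have "lim (\<lambda>n. mcoeff (fps_nth (\<Prod>i<n. petrie_factor k i) (nat m)) a) = ?c"
    by (rule limI)
  then show ?thesis
    using False by (simp add: petrie_def MSeries_inverse nat_eq_iff2 del: of_nat_sum)
qed

definition modular_schur :: "nat \<Rightarrow> nat list \<Rightarrow> int mseries" where
  "modular_schur k lam =
     det (mat (length lam) (length lam)
            (\<lambda>(i, j). petrie k (int (lam ! i) - int i + int j)))"

end

theory Submission
  imports Defs
    "HOL-Library.FuncSet"
    "HOL-Computational_Algebra.Polynomial_FPS"
    "HOL-Computational_Algebra.Fundamental_Theorem_Algebra"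
begin

text \<open>
  Write \<open>s\<^sub>\<lambda>(H) = det (h\<^bsub>\<lambda>\<^sub>i-i+j\<^esub>)\<close> for a complex power series \<open>H = \<Sum> h\<^sub>n X\<^sup>n\<close> with \<open>h\<^sub>0 = 1\<close>; every such \<open>H\<close> is, up
  to any given degree, the generating function of the complete homogeneous functions of some complex numbers.
  By Jacobi-Trudi the hypothesis says \<open>s\<^sub>\<lambda>(H) = s\<^sub>\<lambda>(H / N H)\<close>, where \<open>N H\<close> is the product of \<open>H(\<omega>X)\<close> over the
  \<open>k\<close>-th roots of unity \<open>\<omega>\<close>.  If \<open>N H = 1\<close> and \<open>A\<close> is a series in \<open>X\<^sup>k\<close>, replacing \<open>H A\<^sup>n\<close> by its quotient
  by the norm turns \<open>A\<^sup>n\<close> into \<open>A\<close> to the power \<open>(1 - k) n\<close>; as \<open>s\<^sub>\<lambda>(H A\<^sup>n)\<close> is a polynomial in \<open>n\<close> and \<open>k > 2\<close>,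
  it does not depend on \<open>n\<close>.  Hence \<open>s\<^sub>\<lambda>(H)\<close> does not change when \<open>H\<close> is multiplied by \<open>1 + X\<^sup>k\<close>.  In \<open>l = \<ell>(\<lambda>)\<close>
  variables this is an identity between alternants, which says that subtracting \<open>k\<close> from a beta number
  \<open>\<lambda>\<^sub>i + l - i \<ge> k\<close> always gives another beta number.  Removing a \<open>k\<close>-ribbon would produce one for which
  this fails.
\<close>

section \<open>Jacobi-Trudi determinants\<close>

text \<open>Multilinearity of the determinant in its rows: the weight \<open>w i s\<close> is the
  same in all columns and comes out as a factor. It serves the branching rule and, with Fourier
  weights, the extraction of coefficients.\<close>

lemma det_rows_sum:
  fixes w :: "nat \<Rightarrow> 'b \<Rightarrow> 'a::comm_ring_1"
  assumes "\<And>i. i < n \<Longrightarrow> finite (S i)"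
  shows "det (mat n n (\<lambda>(i, j). \<Sum>s\<in>S i. w i s * f i s j)) =
    (\<Sum>s\<in>PiE {0..<n} S. (\<Prod>i=0..<n. w i (s i)) * det (mat n n (\<lambda>(i, j). f i (s i) j)))"
    (is "?l = ?r")
proof -
  have "?l = (\<Sum>p | p permutes {0..<n}. signof p * (\<Prod>i=0..<n. \<Sum>s\<in>S i. w i s * f i s (p i)))"
    by (subst det_def'[of _ n]) (auto intro!: sum.cong prod.cong)
  also have "\<dots> = (\<Sum>p | p permutes {0..<n}. \<Sum>s\<in>PiE {0..<n} S.
      signof p * (\<Prod>i=0..<n. w i (s i) * f i (s i) (p i)))"
    by (intro sum.cong refl, subst prod_sum_PiE) (auto simp: assms sum_distrib_left)
  also have "\<dots> = (\<Sum>s\<in>PiE {0..<n} S. \<Sum>p | p permutes {0..<n}.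
      signof p * (\<Prod>i=0..<n. w i (s i) * f i (s i) (p i)))"
    by (rule sum.swap)
  also have "\<dots> = ?r"
    by (rule sum.cong[OF refl], subst det_def'[of _ n])
       (auto simp: prod.distrib sum_distrib_left mult_ac intro!: sum.cong prod.cong)
  finally show ?thesis .
qed

lemma det_zero_row:
  fixes A :: "'a::comm_ring_1 mat"
  assumes "A \<in> carrier_mat n n" "i < n" "\<And>j. j < n \<Longrightarrow> A $$ (i, j) = 0"
  shows "det A = 0"
  using assms(3) by (subst laplace_expansion_row[OF assms(1,2)]) simp

text \<open>Jacobi-Trudi entries may have a negative index; the coefficient is then 0, as for
  \<open>petrie\<close>.\<close>

definition nth_int :: "'a::zero fps \<Rightarrow> int \<Rightarrow> 'a" where
  "nth_int F n = (if n < 0 then 0 else fps_nth F (nat n))"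

definition jacobi_trudi :: "'a::comm_ring_1 fps \<Rightarrow> nat list \<Rightarrow> 'a" where
  "jacobi_trudi F lam = det (mat (length lam) (length lam)
     (\<lambda>(i, j). nth_int F (int (lam ! i) - int i + int j)))"

definition next_part :: "nat list \<Rightarrow> nat \<Rightarrow> nat" where
  "next_part lam i = (if Suc i < length lam then lam ! Suc i else 0)"

text \<open>The \<open>s\<close> for which \<open>lam / s\<close> is a horizontal strip. All keep
  \<open>length lam\<close> rows, so zeros may occur; hence the lemmas below assume sortedness
  rather than \<open>is_partition\<close>.\<close>

definition interlacing :: "nat list \<Rightarrow> (nat \<Rightarrow> nat) set" where
  "interlacing lam = PiE {0..<length lam} (\<lambda>i. {next_part lam i..lam ! i})"

abbreviation list_of :: "nat list \<Rightarrow> (nat \<Rightarrow> nat) \<Rightarrow> nat list" where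
  "list_of lam s \<equiv> map s [0..<length lam]"

text \<open>Since \<open>f n = h n - x * h (n - 1)\<close>, the sum telescopes.\<close>

lemma geometric_step:
  fixes f h :: "int \<Rightarrow> 'a::comm_ring_1"
  assumes "\<And>n. h n = f n + x * h (n - 1)"
  shows "(\<Sum>s=b..b+d. x ^ (b + d - s) * f (int s + c)) = h (int (b + d) + c) - x ^ Suc d * h (int b + c - 1)"
proof (induction d)
  case 0
  show ?case using assms[of "int b + c"] by simp
next
  case (Suc d)
  have sum: "(\<Sum>s=b..b+Suc d. x ^ (b + Suc d - s) * f (int s + c)) =
      x * (\<Sum>s=b..b+d. x ^ (b + d - s) * f (int s + c)) + f (int (b + Suc d) + c)"
    by (simp add: sum_distrib_left Suc_diff_le mult_ac)
  have "h (int (b + Suc d) + c) = f (int (b + Suc d) + c) + x * h (int (b + d) + c)"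
    using assms[of "int (b + Suc d) + c"] by (simp add: algebra_simps)
  then show ?case
    unfolding sum Suc.IH by (simp add: algebra_simps)
qed

lemma nth_int_fps_X_mult: "nth_int (fps_X * F) n = nth_int (F::'a::comm_ring_1 fps) (n - 1)"
  by (auto simp: nth_int_def nat_diff_distrib')

text \<open>Passing from \<open>F\<close> to \<open>H = F / (1 - x X)\<close> adjoins one variable
  with value \<open>x\<close>. Subtracting a multiple of the next row from each row turns every
  entry into a telescoped sum, which multilinearity expands.\<close>

lemma jacobi_trudi_branching:
  fixes F H :: "'a::comm_ring_1 fps"
  assumes H: "H = F + fps_const x * fps_X * H"
    and lam: "sorted_wrt (\<ge>) lam"
  shows "jacobi_trudi H lam =
    (\<Sum>s\<in>interlacing lam. (\<Prod>i=0..<length lam. x ^ (lam ! i - s i)) * jacobi_trudi F (list_of lam s))"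
proof -
  let ?l = "length lam"
  have rec: "nth_int H n = nth_int F n + x * nth_int H (n - 1)" for n
  proof -
    have "nth_int H n = nth_int (F + fps_const x * (fps_X * H)) n"
      using H by (simp add: mult.assoc)
    also have "\<dots> = nth_int F n + x * nth_int (fps_X * H) n"
      by (simp add: nth_int_def)
    finally show ?thesis by (simp add: nth_int_fps_X_mult)
  qed
  have le: "next_part lam i \<le> lam ! i" if "i < ?l" for i
    using that lam by (auto simp: next_part_def sorted_wrt_iff_nth_less)
  let ?A = "mat ?l ?l (\<lambda>(i, j). nth_int H (int (lam ! i) - int i + int j))"
  let ?c = "\<lambda>i. x ^ Suc (lam ! i - next_part lam i)"
  \<comment> \<open>All row operations at once; the exponent in \<open>?c\<close> is the one
    produced by \<open>geometric_step\<close> for the range from \<open>next_part lam i\<close> to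
    \<open>lam ! i\<close>.\<close>
  let ?D = "mat ?l ?l (\<lambda>(i, j). if j = i then 1 else if j = Suc i then - ?c i else 0)"
  have detD: "det ?D = 1"
    by (subst det_upper_triangular[of _ ?l]) (auto simp: prod_list_diag_prod intro!: prod.neutral)
  have "?D * ?A = mat ?l ?l (\<lambda>(i, j). \<Sum>s\<in>{next_part lam i..lam ! i}.
      x ^ (lam ! i - s) * nth_int F (int s - int i + int j))"
  proof (rule eq_matI)
    fix i j assume "i < dim_row (mat ?l ?l (\<lambda>(i, j). \<Sum>s\<in>{next_part lam i..lam ! i}.
      x ^ (lam ! i - s) * nth_int F (int s - int i + int j)))"
      "j < dim_col (mat ?l ?l (\<lambda>(i, j). \<Sum>s\<in>{next_part lam i..lam ! i}.
      x ^ (lam ! i - s) * nth_int F (int s - int i + int j)))"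
    then have i: "i < ?l" and j: "j < ?l" by auto
    have "(\<Sum>s\<in>{next_part lam i..lam ! i}. x ^ (lam ! i - s) * nth_int F (int s - int i + int j)) =
      nth_int H (int (lam ! i) - int i + int j) - ?c i * nth_int H (int (next_part lam i) - int i - 1 + int j)"
      using geometric_step[of "nth_int H" "nth_int F" x "next_part lam i" "lam ! i - next_part lam i"
          "int j - int i", OF rec] le[OF i] by (simp add: algebra_simps)
    moreover have "(?D * ?A) $$ (i, j) = (\<Sum>k<?l. (if k = i then 1 else if k = Suc i then - ?c i else 0) *
        nth_int H (int (lam ! k) - int k + int j))"
      using i j by (simp add: scalar_prod_def atLeast0LessThan)
    moreover have "\<dots> = (\<Sum>k<?l. (if k = i then nth_int H (int (lam ! i) - int i + int j) else 0) +
        (if k = Suc i then - ?c i * nth_int H (int (lam ! Suc i) - int (Suc i) + int j) else 0))"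
      by (intro sum.cong) auto
    moreover have "\<dots> = nth_int H (int (lam ! i) - int i + int j) +
        (if Suc i < ?l then - ?c i * nth_int H (int (lam ! Suc i) - int (Suc i) + int j) else 0)"
      using i by (simp add: sum.distrib)
    \<comment> \<open>The last row has no successor: with \<open>next_part\<close> equal to 0 the
      missing term has a negative index.\<close>
    moreover have "nth_int H (int (next_part lam i) - int i - 1 + int j) = 0" if "\<not> Suc i < ?l"
      using that i j by (auto simp: next_part_def nth_int_def)
    ultimately show "(?D * ?A) $$ (i, j) = mat ?l ?l (\<lambda>(i, j). \<Sum>s\<in>{next_part lam i..lam ! i}.
      x ^ (lam ! i - s) * nth_int F (int s - int i + int j)) $$ (i, j)"
      using i j by (auto simp: next_part_def algebra_simps)
  qed auto
  then have "det (?D * ?A) = det (mat ?l ?l (\<lambda>(i, j). \<Sum>s\<in>{next_part lam i..lam ! i}.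
      x ^ (lam ! i - s) * nth_int F (int s - int i + int j)))"
    by simp
  also have "\<dots> = (\<Sum>s\<in>interlacing lam. (\<Prod>i=0..<?l. x ^ (lam ! i - s i)) *
      det (mat ?l ?l (\<lambda>(i, j). nth_int F (int (s i) - int i + int j))))"
    unfolding interlacing_def by (rule det_rows_sum) simp
  also have "\<dots> = (\<Sum>s\<in>interlacing lam. (\<Prod>i=0..<length lam. x ^ (lam ! i - s i)) * jacobi_trudi F (list_of lam s))"
    by (intro sum.cong refl arg_cong2[where f = "(*)"])
       (auto simp: jacobi_trudi_def intro!: arg_cong[where f = det] cong_mat)
  finally show ?thesis
    by (subst (asm) det_mult[of _ ?l]) (auto simp: detD jacobi_trudi_def)
qed

text \<open>The case of no variables. If some part is positive, so is the first, and row 0 consists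
  of coefficients of 1 at positive indices.\<close>

lemma jacobi_trudi_one:
  assumes "sorted_wrt (\<ge>) lam"
  shows "jacobi_trudi (1 :: 'a::comm_ring_1 fps) lam = (if \<forall>i<length lam. lam ! i = 0 then 1 else 0)"
proof (cases "\<forall>i<length lam. lam ! i = 0")
  case True
  have "jacobi_trudi (1 :: 'a fps) lam = det (1\<^sub>m (length lam))"
    unfolding jacobi_trudi_def
    by (intro arg_cong[where f = det] eq_matI) (use True in \<open>auto simp: nth_int_def fps_one_nth\<close>)
  then show ?thesis using True by simp
next
  case False
  then obtain i where "i < length lam" "lam ! i \<noteq> 0" by auto
  then have l: "0 < length lam" and pos: "0 < lam ! 0"
    using assms by (cases "i = 0"; fastforce simp: sorted_wrt_iff_nth_less)+
  have "jacobi_trudi (1 :: 'a fps) lam = 0"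
    unfolding jacobi_trudi_def
    by (rule det_zero_row[of _ "length lam" 0]) (use l pos in \<open>auto simp: nth_int_def fps_one_nth\<close>)
  then show ?thesis using False by auto
qed

section \<open>Semistandard tableaux and their branching rule\<close>

definition bounded_ssyt :: "nat \<Rightarrow> nat list \<Rightarrow> (nat \<times> nat \<Rightarrow> nat) set" where
  "bounded_ssyt N lam = {T \<in> ssyt lam. \<forall>c\<in>diagram lam. T c < N}"

definition tableau_sum :: "(nat \<Rightarrow> 'a::comm_ring_1) \<Rightarrow> nat \<Rightarrow> nat list \<Rightarrow> 'a" where
  "tableau_sum x N lam = (\<Sum>T\<in>bounded_ssyt N lam. \<Prod>c\<in>diagram lam. x (T c))"

lemma finite_bounded_ssyt: "finite (bounded_ssyt N lam)"
proof (rule finite_subset)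
  show "bounded_ssyt N lam \<subseteq>
      {T. \<forall>c. (c \<in> diagram lam \<longrightarrow> T c \<in> {..<N}) \<and> (c \<notin> diagram lam \<longrightarrow> T c = 0)}"
    by (auto simp: bounded_ssyt_def ssyt_def)
qed (intro finite_set_of_finite_funs finite_diagram finite_lessThan)

lemma mem_diagram [simp]: "(i, j) \<in> diagram lam \<longleftrightarrow> i < length lam \<and> j < lam ! i"
  by (simp add: diagram_def)

lemma ssytD:
  assumes "T \<in> ssyt lam"
  shows "c \<notin> diagram lam \<Longrightarrow> T c = 0"
    and "i < length lam \<Longrightarrow> Suc j < lam ! i \<Longrightarrow> T (i, j) \<le> T (i, Suc j)"
    and "Suc i < length lam \<Longrightarrow> j < lam ! Suc i \<Longrightarrow> T (i, j) < T (Suc i, j)"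
  using assms by (cases c; auto simp: ssyt_def)+

lemma ssyt_row_mono:
  assumes "T \<in> ssyt lam" "i < length lam" "j \<le> j'" "j' < lam ! i"
  shows "T (i, j) \<le> T (i, j')"
  using assms(3,4)
proof (induction j' rule: dec_induct)
  case (step m)
  then show ?case using ssytD(2)[OF assms(1,2), of m] by simp
qed simp

text \<open>\<open>restrict\<close> makes the sequence an element of the extensional product
  \<open>interlacing lam\<close>.\<close>

definition row_lengths_below :: "nat \<Rightarrow> nat list \<Rightarrow> (nat \<times> nat \<Rightarrow> nat) \<Rightarrow> nat \<Rightarrow> nat" where
  "row_lengths_below N lam T = restrict (\<lambda>i. card {j. j < lam ! i \<and> T (i, j) < N}) {0..<length lam}"

text \<open>Rows increase weakly, so the columns with entry below \<open>N\<close> form an initial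
  segment.\<close>

lemma row_below:
  assumes "T \<in> ssyt lam" "i < length lam"
  shows "{j. j < lam ! i \<and> T (i, j) < N} = {..<row_lengths_below N lam T i}"
proof -
  let ?S = "{j. j < lam ! i \<and> T (i, j) < N}"
  have fin: "finite ?S" by simp
  have down: "j \<in> ?S" if "j \<le> j'" "j' \<in> ?S" for j j'
    using ssyt_row_mono[OF assms that(1)] that by auto
  have "?S = {..<card ?S}"
  proof (intro card_subset_eq[symmetric] subsetI)
    fix j assume j: "j \<in> {..<card ?S}"
    show "j \<in> ?S"
    proof (rule ccontr)
      assume "j \<notin> ?S"
      then have "?S \<subseteq> {..<j}" using down by (force simp: not_le[symmetric])
      then have "card ?S \<le> j" using card_mono[of "{..<j}" ?S] by simp
      then show False using j by simp
    qed
  qed (auto simp: fin)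
  then show ?thesis using assms(2) by (simp add: row_lengths_below_def)
qed

text \<open>Deleting the entries \<open>N\<close> from a tableau with entries at most
  \<open>N\<close> leaves one with entries below \<open>N\<close>. Strict columns contain at most
  one \<open>N\<close>, so a horizontal strip is deleted; conversely every horizontal strip can be
  filled with \<open>N\<close>.\<close>

lemma tableau_sum_branching:
  assumes lam: "sorted_wrt (\<ge>) lam"
  shows "tableau_sum x (Suc N) lam =
    (\<Sum>s\<in>interlacing lam. (\<Prod>i=0..<length lam. x N ^ (lam ! i - s i)) * tableau_sum x N (list_of lam s))"
proof -
  let ?l = "length lam"
  let ?glue = "\<lambda>(s, T) (i, j). if (i, j) \<in> diagram lam then if j < s i then T (i, j) else N else 0"
  let ?cut = "\<lambda>T. (row_lengths_below N lam T, \<lambda>c. if c \<in> diagram lam \<and> T c < N then T c else 0)"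
  let ?Z = "SIGMA s:interlacing lam. bounded_ssyt N (list_of lam s)"
  have il: "next_part lam i \<le> s i" "s i \<le> lam ! i" if "s \<in> interlacing lam" "i < ?l" for s i
    using that by (auto simp: interlacing_def PiE_def Pi_def)
  have il': "j < s i" if "s \<in> interlacing lam" "Suc i < ?l" "j < lam ! Suc i" for s i j
    using il(1)[OF that(1), of i] that by (auto simp: next_part_def)
  have cut: "?cut T \<in> ?Z" "?glue (?cut T) = T" if T: "T \<in> bounded_ssyt (Suc N) lam" for T
  proof -
    let ?s = "row_lengths_below N lam T"
    have T2: "T (i, j) \<le> N" if "i < ?l" "j < lam ! i" for i j
      using T that by (auto simp: bounded_ssyt_def less_Suc_eq_le)
    have T1: "T \<in> ssyt lam" using T by (simp add: bounded_ssyt_def)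
    have s: "j < ?s i \<longleftrightarrow> j < lam ! i \<and> T (i, j) < N" if "i < ?l" for i j
      using row_below[OF T1 that, of N] by blast
    have "?s \<in> interlacing lam"
      unfolding interlacing_def
    proof (rule PiE_I)
      fix i assume "i \<in> {0..<?l}"
      then have i: "i < ?l" by simp
      have "?s i \<le> lam ! i"
        using s[OF i] by (metis not_le order.irrefl)
      \<comment> \<open>A box with another one directly below it holds less than \<open>N\<close>,
        as the lower one holds at most \<open>N\<close>.\<close>
      moreover have "j < ?s i" if "Suc i < ?l" "j < lam ! Suc i" for j
      proof -
        have "j < lam ! i"
          using lam that by (metis sorted_wrt_iff_nth_less lessI order_less_le_trans)
        moreover have "T (i, j) < N"
          using ssytD(3)[OF T1 that] T2[OF that] by simp
        ultimately show ?thesis using s[OF i] by simp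
      qed
      then have "next_part lam i \<le> ?s i"
        unfolding next_part_def by (metis le0 not_le order.irrefl)
      ultimately show "?s i \<in> {next_part lam i..lam ! i}" by simp
    next
      fix i assume "i \<notin> {0..<?l}"
      then show "?s i = undefined" by (auto simp: row_lengths_below_def)
    qed
    moreover have "(\<lambda>c. if c \<in> diagram lam \<and> T c < N then T c else 0) \<in> bounded_ssyt N (list_of lam ?s)"
      unfolding bounded_ssyt_def ssyt_def
    proof (intro CollectI conjI allI ballI impI, goal_cases)
      case (1 c)
      then show ?case by (cases c) (auto simp: s)
    next
      case (2 i j)
      then show ?case using ssytD(2)[OF T1, of i j] by (auto simp: s)
    next
      case (3 i j)
      then have "Suc i < ?l" "j < lam ! Suc i" "T (Suc i, j) < N" by (auto simp: s)
      moreover from this have "j < lam ! i"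
        using lam by (metis sorted_wrt_iff_nth_less lessI order_less_le_trans)
      ultimately show ?case using ssytD(3)[OF T1, of i j] by auto
    next
      case (4 c)
      then show ?case by (cases c) (auto simp: s)
    qed
    ultimately show "?cut T \<in> ?Z" by simp
    show "?glue (?cut T) = T"
    proof
      fix c :: "nat \<times> nat"
      obtain i j where "c = (i, j)" by (cases c)
      then show "?glue (?cut T) c = T c"
        using s[of i j] T2[of i j] ssytD(1)[OF T1, of c] by auto
    qed
  qed
  have glue: "?glue z \<in> bounded_ssyt (Suc N) lam" "?cut (?glue z) = z" if "z \<in> ?Z" for z
  proof -
    obtain s T where z: "z = (s, T)" by (cases z)
    then have s: "s \<in> interlacing lam" and T: "T \<in> bounded_ssyt N (list_of lam s)"
      using that by auto
    have T2: "T (i, j) < N" if "i < ?l" "j < s i" for i j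
      using T that by (auto simp: bounded_ssyt_def)
    have T1: "T \<in> ssyt (list_of lam s)" using T by (simp add: bounded_ssyt_def)
    have lt: "?glue z (i, j) < N \<longleftrightarrow> j < s i" if "i < ?l" "j < lam ! i" for i j
      using that T2[of i j] by (auto simp: z)
    show "?glue z \<in> bounded_ssyt (Suc N) lam"
      unfolding bounded_ssyt_def ssyt_def
    proof (intro CollectI conjI allI ballI impI, goal_cases)
      case (1 c)
      then show ?case by (cases c) (auto simp: z)
    next
      case (2 i j)
      then show ?case using ssytD(2)[OF T1, of i j] T2[of i j] by (auto simp: z intro: less_imp_le)
    next
      case (3 i j)
      then have "Suc i < ?l" "j < lam ! Suc i" by auto
      moreover from this have "j < lam ! i"
        using lam by (metis sorted_wrt_iff_nth_less lessI order_less_le_trans)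
      moreover have "j < s i" using il'[OF s] 3 by simp
      ultimately show ?case using ssytD(3)[OF T1, of i j] T2[of i j] by (auto simp: z)
    next
      case (4 c)
      then show ?case using T2[of "fst c" "snd c"] by (cases c) (auto simp: z less_Suc_eq)
    qed
    have "row_lengths_below N lam (?glue z) = s"
    proof
      fix i
      show "row_lengths_below N lam (?glue z) i = s i"
      proof (cases "i < ?l")
        case True
        then have "{j. j < lam ! i \<and> ?glue z (i, j) < N} = {..<s i}"
          using lt[OF True] il(2)[OF s True] by auto
        then show ?thesis using True by (simp add: row_lengths_below_def)
      next
        case False
        then show ?thesis using s by (auto simp: row_lengths_below_def interlacing_def PiE_def extensional_def)
      qed
    qed
    moreover have "(\<lambda>c. if c \<in> diagram lam \<and> ?glue z c < N then ?glue z c else 0) = T"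
    proof (rule ext, clarify)
      fix i j
      show "(if (i, j) \<in> diagram lam \<and> ?glue z (i, j) < N then ?glue z (i, j) else 0) = T (i, j)"
        using lt[of i j] il(2)[OF s, of i] ssytD(1)[OF T1, of "(i, j)"]
        by (cases "i < ?l") (auto simp: z)
    qed
    ultimately show "?cut (?glue z) = z" by (simp add: z)
  qed
  have weight: "(\<Prod>c\<in>diagram lam. x (?glue (s, T) c)) =
      (\<Prod>i=0..<?l. x N ^ (lam ! i - s i)) * (\<Prod>c\<in>diagram (list_of lam s). x (T c))"
    if s: "s \<in> interlacing lam" for s T
  proof -
    have sub: "diagram (list_of lam s) \<subseteq> diagram lam"
    proof clarify
      fix i j assume "(i, j) \<in> diagram (list_of lam s)"
      then show "(i, j) \<in> diagram lam" using il(2)[OF s, of i] by auto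
    qed
    have diff: "diagram lam - diagram (list_of lam s) = (SIGMA i:{0..<?l}. {s i..<lam ! i})"
      by auto
    have "(\<Prod>c\<in>diagram lam. x (?glue (s, T) c)) =
        (\<Prod>c\<in>diagram lam - diagram (list_of lam s). x (?glue (s, T) c)) *
        (\<Prod>c\<in>diagram (list_of lam s). x (?glue (s, T) c))"
      by (rule prod.subset_diff[OF sub finite_diagram])
    also have "(\<Prod>c\<in>diagram (list_of lam s). x (?glue (s, T) c)) =
        (\<Prod>c\<in>diagram (list_of lam s). x (T c))"
    proof (rule prod.cong[OF refl])
      fix c assume "c \<in> diagram (list_of lam s)"
      then show "x (?glue (s, T) c) = x (T c)"
        using il(2)[OF s, of "fst c"] by (cases c) auto
    qed
    also have "(\<Prod>c\<in>diagram lam - diagram (list_of lam s). x (?glue (s, T) c)) =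
        (\<Prod>c\<in>(SIGMA i:{0..<?l}. {s i..<lam ! i}). x N)"
      unfolding diff by (intro prod.cong) auto
    also have "\<dots> = (\<Prod>i=0..<?l. x N ^ (lam ! i - s i))"
      by (subst prod.Sigma[symmetric, of _ _ "\<lambda>_ _. x N", simplified split_def]) auto
    finally show ?thesis .
  qed
  have "tableau_sum x (Suc N) lam =
      (\<Sum>(s, T)\<in>?Z. (\<Prod>i=0..<?l. x N ^ (lam ! i - s i)) * (\<Prod>c\<in>diagram (list_of lam s). x (T c)))"
    unfolding tableau_sum_def
  proof (rule sum.reindex_bij_witness[where i = ?glue and j = ?cut], goal_cases)
    case (5 T)
    have "row_lengths_below N lam T \<in> interlacing lam" using cut(1)[OF 5] by simp
    then show ?case
      using weight[of "row_lengths_below N lam T" "snd (?cut T)"] cut(2)[OF 5] by simp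
  qed (use cut glue in blast)+
  also have "\<dots> = (\<Sum>s\<in>interlacing lam. \<Sum>T\<in>bounded_ssyt N (list_of lam s).
      (\<Prod>i=0..<?l. x N ^ (lam ! i - s i)) * (\<Prod>c\<in>diagram (list_of lam s). x (T c)))"
    by (subst sum.Sigma) (auto simp: finite_bounded_ssyt interlacing_def intro!: finite_PiE)
  finally show ?thesis
    by (simp add: tableau_sum_def sum_distrib_left)
qed

lemma tableau_sum_0: "tableau_sum x 0 lam = (if \<forall>i<length lam. lam ! i = 0 then 1 else 0)"
proof (cases "diagram lam = {}")
  case True
  then have "bounded_ssyt 0 lam = {\<lambda>_. 0}"
    unfolding bounded_ssyt_def ssyt_def by auto
  moreover have "\<forall>i<length lam. lam ! i = 0"
    using True mem_diagram[of _ 0 lam] by auto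
  ultimately show ?thesis using True by (simp add: tableau_sum_def)
next
  case False
  then have "bounded_ssyt 0 lam = {}"
    unfolding bounded_ssyt_def by auto
  moreover have "\<not> (\<forall>i<length lam. lam ! i = 0)"
    using False by (force simp: diagram_def)
  ultimately show ?thesis by (auto simp: tableau_sum_def)
qed

abbreviation linear_factor :: "'a::comm_ring_1 \<Rightarrow> 'a fps" where
  "linear_factor c \<equiv> 1 - fps_const c * fps_X"

lemma linear_factor_inverse: "inverse (linear_factor c) * linear_factor (c::'a::field) = 1"
  by (rule inverse_mult_eq_1) simp

text \<open>Both sides obey the same recursion in the number of variables and agree when there are
  none.\<close>

theorem jacobi_trudi_identity:
  fixes x :: "nat \<Rightarrow> 'a::field"
  assumes "sorted_wrt (\<ge>) lam"
  shows "tableau_sum x N lam = jacobi_trudi (\<Prod>i<N. inverse (linear_factor (x i))) lam"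
  using assms
proof (induction N arbitrary: lam)
  case 0
  then show ?case by (simp add: tableau_sum_0 jacobi_trudi_one)
next
  case (Suc N)
  let ?F = "\<Prod>i<N. inverse (linear_factor (x i))"
  let ?H = "\<Prod>i<Suc N. inverse (linear_factor (x i))"
  have "?H * linear_factor (x N) = ?F"
    by (simp add: linear_factor_inverse mult.assoc)
  then have H: "?H = ?F + fps_const (x N) * fps_X * ?H"
    by (simp add: algebra_simps)
  \<comment> \<open>Interlacing keeps the order:
    \<open>s j \<le> lam ! j \<le> lam ! Suc i \<le> s i\<close> for \<open>i < j\<close>.\<close>
  have "sorted_wrt (\<ge>) (list_of lam s)" if s: "s \<in> interlacing lam" for s
    unfolding sorted_wrt_iff_nth_less
  proof (intro allI impI)
    fix i j assume ij: "i < j" "j < length (list_of lam s)"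
    then have "s j \<le> lam ! j" "next_part lam i \<le> s i"
      using s by (auto simp: interlacing_def PiE_def Pi_def)
    moreover have "lam ! j \<le> lam ! Suc i"
      using ij Suc.prems by (cases "j = Suc i") (auto simp: sorted_wrt_iff_nth_less)
    ultimately show "list_of lam s ! j \<le> list_of lam s ! i"
      using ij by (simp add: next_part_def)
  qed
  then show ?case
    unfolding jacobi_trudi_branching[OF H Suc.prems] tableau_sum_branching[OF Suc.prems]
    by (intro sum.cong refl) (simp add: Suc.IH)
qed

section \<open>Evaluation at finitely many numbers\<close>

lemma fps_const_sum: "(\<Sum>i\<in>A. fps_const (f i)) = fps_const (\<Sum>i\<in>A. f i)"
  by (induction A rule: infinite_finite_induct) simp_all

lemma fps_const_prod: "(\<Prod>i\<in>A. fps_const (f i)) = fps_const (\<Prod>i\<in>A. f i)"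
  by (induction A rule: infinite_finite_induct) simp_all

definition monomials :: "nat \<Rightarrow> nat \<Rightarrow> (nat \<Rightarrow>\<^sub>0 nat) set" where
  "monomials N n = {a. Poly_Mapping.keys a \<subseteq> {..<N} \<and> (\<Sum>i<N. Poly_Mapping.lookup a i) = n}"

definition monomial_of :: "nat \<Rightarrow> (nat \<Rightarrow> nat) \<Rightarrow> (nat \<Rightarrow>\<^sub>0 nat)" where
  "monomial_of N s = (\<Sum>i<N. Poly_Mapping.single i (s i))"

lemma lookup_monomial_of:
  "Poly_Mapping.lookup (monomial_of N s) j = (if j < N then s j else 0)"
  by (simp add: monomial_of_def lookup_sum lookup_single when_def)

lemma keys_monomial_of: "Poly_Mapping.keys (monomial_of N s) \<subseteq> {..<N}"
  by (auto simp: in_keys_iff lookup_monomial_of split: if_splits)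

lemma monomial_of_lookup:
  assumes "Poly_Mapping.keys a \<subseteq> {..<N}"
  shows "monomial_of N (Poly_Mapping.lookup a) = a"
  by (intro poly_mapping_eqI) (use assms in \<open>auto simp: lookup_monomial_of in_keys_iff subset_iff\<close>)

lemma finite_monomials: "finite (monomials N n)"
proof (rule finite_subset)
  show "monomials N n \<subseteq> monomial_of N ` PiE {..<N} (\<lambda>_. {..n})"
  proof
    fix a assume a: "a \<in> monomials N n"
    then have "Poly_Mapping.lookup a i \<le> n" if "i < N" for i
      using that member_le_sum[of i "{..<N}" "Poly_Mapping.lookup a"] by (auto simp: monomials_def)
    moreover have "monomial_of N (restrict (Poly_Mapping.lookup a) {..<N}) = a"
      using a monomial_of_lookup[of a N] by (simp add: monomials_def monomial_of_def)
    ultimately show "a \<in> monomial_of N ` PiE {..<N} (\<lambda>_. {..n})"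
      by (intro image_eqI[of _ _ "restrict (Poly_Mapping.lookup a) {..<N}"]) auto
  qed
qed (intro finite_imageI finite_PiE, auto)

lemma degree_eq_sum_keys:
  assumes "a \<in> monomials N n"
  shows "(\<Sum>i\<in>Poly_Mapping.keys a. Poly_Mapping.lookup a i) = n"
proof -
  have "(\<Sum>i\<in>Poly_Mapping.keys a. Poly_Mapping.lookup a i) = (\<Sum>i<N. Poly_Mapping.lookup a i)"
    by (rule sum.mono_neutral_left) (use assms in \<open>auto simp: monomials_def in_keys_iff\<close>)
  then show ?thesis using assms by (simp add: monomials_def)
qed

definition monomial_value :: "(nat \<Rightarrow> 'a::comm_ring_1) \<Rightarrow> nat \<Rightarrow> (nat \<Rightarrow>\<^sub>0 nat) \<Rightarrow> 'a" where
  "monomial_value x N a = (\<Prod>i<N. x i ^ Poly_Mapping.lookup a i)"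

lemma monomial_value_add: "monomial_value x N (a + b) = monomial_value x N a * monomial_value x N b"
  by (simp add: monomial_value_def lookup_add power_add prod.distrib)

text \<open>A series in infinitely many variables need not have a value, but its homogeneous parts do
  once all but finitely many variables are set to zero; the fps variable records the degree.\<close>

definition graded_eval :: "(nat \<Rightarrow> 'a::comm_ring_1) \<Rightarrow> nat \<Rightarrow> int mseries \<Rightarrow> 'a fps" where
  "graded_eval x N f = Abs_fps (\<lambda>n. \<Sum>a\<in>monomials N n. of_int (mcoeff f a) * monomial_value x N a)"

lemma graded_eval_mult: "graded_eval x N (f * g) = graded_eval x N f * graded_eval x N g"
proof (rule fps_ext)
  fix n
  let ?v = "monomial_value x N"
  let ?D = "\<lambda>a. \<Sum>i<N. Poly_Mapping.lookup a i"
  let ?h = "\<lambda>b c. (of_int (mcoeff f b) * ?v b) * (of_int (mcoeff g c) * ?v c)"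
  have keys: "Poly_Mapping.keys (b + c) = Poly_Mapping.keys b \<union> Poly_Mapping.keys c" for b c :: "nat \<Rightarrow>\<^sub>0 nat"
    by (auto simp: in_keys_iff lookup_add)
  have "fps_nth (graded_eval x N (f * g)) n =
      (\<Sum>a\<in>monomials N n. \<Sum>p\<in>{p. fst p + snd p = a}. ?h (fst p) (snd p))"
    by (auto simp: graded_eval_def times_mseries.rep_eq sum_distrib_left case_prod_unfold
        monomial_value_add mult_ac intro!: sum.cong)
  also have "\<dots> = (\<Sum>(a, p)\<in>(SIGMA a:monomials N n. {p. fst p + snd p = a}). ?h (fst p) (snd p))"
    by (rule sum.Sigma) (auto simp: finite_monomials finite_monomial_splits')
  \<comment> \<open>Factorisations of monomials of degree \<open>n\<close> are sorted by the degree
    \<open>i\<close> of the first factor.\<close>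
  also have "\<dots> = (\<Sum>(i, p)\<in>(SIGMA i:{0..n}. monomials N i \<times> monomials N (n - i)). ?h (fst p) (snd p))"
    by (rule sum.reindex_bij_witness[where i = "\<lambda>(i, p). (fst p + snd p, p)" and j = "\<lambda>(a, p). (?D (fst p), p)"])
       (auto simp: monomials_def keys lookup_add sum.distrib)
  also have "\<dots> = (\<Sum>i=0..n. \<Sum>p\<in>monomials N i \<times> monomials N (n - i). ?h (fst p) (snd p))"
    by (subst sum.Sigma) (auto simp: finite_monomials)
  also have "\<dots> = fps_nth (graded_eval x N f * graded_eval x N g) n"
    by (simp add: graded_eval_def fps_mult_nth sum_product sum.cartesian_product case_prod_unfold)
  finally show "fps_nth (graded_eval x N (f * g)) n = fps_nth (graded_eval x N f * graded_eval x N g) n" .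
qed

lemma comm_ring_hom_graded_eval: "comm_ring_hom (graded_eval x N)"
proof unfold_locales
  show "graded_eval x N (f + g) = graded_eval x N f + graded_eval x N g" for f g
    by (intro fps_ext) (simp add: graded_eval_def plus_mseries.rep_eq sum.distrib distrib_right)
next
  show "graded_eval x N 1 = 1"
  proof (rule fps_ext)
    fix n
    have "fps_nth (graded_eval x N 1) n = (\<Sum>a\<in>monomials N n. if a = 0 then 1 else 0)"
      by (auto simp: graded_eval_def one_mseries.rep_eq monomial_value_def intro!: sum.cong)
    also have "\<dots> = (if n = 0 then 1 else 0)"
      using finite_monomials[of N n] by (auto simp: monomials_def)
    finally show "fps_nth (graded_eval x N 1) n = fps_nth 1 n" by simp
  qed
next
  show "graded_eval x N (f * g) = graded_eval x N f * graded_eval x N g" for f g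
    by (rule graded_eval_mult)
next
  show "graded_eval x N 0 = 0"
    by (intro fps_ext) (simp add: graded_eval_def zero_mseries.rep_eq)
qed

section \<open>Values of Petrie, modular Schur and Schur functions\<close>

definition petrie_product :: "(nat \<Rightarrow> 'a::comm_ring_1) \<Rightarrow> nat \<Rightarrow> nat \<Rightarrow> 'a fps" where
  "petrie_product x N k = (\<Prod>i<N. \<Sum>j<k. (fps_const (x i) * fps_X) ^ j)"

text \<open>Expanding the product chooses an exponent below \<open>k\<close> for each
  variable.\<close>

lemma petrie_product_nth:
  assumes "k > 0"
  shows "fps_nth (petrie_product x N k) n =
    (\<Sum>a | a \<in> monomials N n \<and> (\<forall>i\<in>Poly_Mapping.keys a. Poly_Mapping.lookup a i < k). monomial_value x N a)"
proof -
  let ?P = "PiE {..<N} (\<lambda>_. {..<k})"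
  have fin: "finite ?P" by (intro finite_PiE) auto
  have "petrie_product x N k = (\<Sum>s\<in>?P. \<Prod>i<N. (fps_const (x i) * fps_X) ^ s i)"
    unfolding petrie_product_def by (rule prod_sum_PiE) auto
  also have "\<dots> = (\<Sum>s\<in>?P. fps_const (\<Prod>i<N. x i ^ s i) * fps_X ^ (\<Sum>i<N. s i))"
    by (simp add: power_mult_distrib prod.distrib power_sum fps_const_prod)
  finally have eq: "petrie_product x N k = \<dots>" .
  have "fps_nth (petrie_product x N k) n = (\<Sum>s\<in>?P. if n = (\<Sum>i<N. s i) then \<Prod>i<N. x i ^ s i else 0)"
    unfolding eq fps_sum_nth by (rule sum.cong[OF refl]) simp
  also have "\<dots> = (\<Sum>s | s \<in> ?P \<and> n = (\<Sum>i<N. s i). \<Prod>i<N. x i ^ s i)"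
    by (rule sum.inter_filter[OF fin, symmetric])
  also have "\<dots> = (\<Sum>a | a \<in> monomials N n \<and> (\<forall>i\<in>Poly_Mapping.keys a. Poly_Mapping.lookup a i < k). monomial_value x N a)"
  proof (rule sum.reindex_bij_witness[where j = "monomial_of N" and i = "\<lambda>a. restrict (Poly_Mapping.lookup a) {..<N}"], goal_cases)
    case (1 s)
    then show ?case by (auto simp: lookup_monomial_of PiE_def extensional_def)
  next
    case (2 s)
    then have "s i < k" if "i < N" for i using that by (auto simp: PiE_def Pi_def)
    then show ?case using 2 keys_monomial_of[of N s] by (auto simp: monomials_def lookup_monomial_of)
  next
    case (3 a)
    then show ?case using monomial_of_lookup[of a N] by (simp add: monomials_def monomial_of_def)
  next
    case (4 a)
    then have "Poly_Mapping.lookup a i < k" for i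
      using assms by (cases "i \<in> Poly_Mapping.keys a") (auto simp: in_keys_iff)
    then show ?case using 4 by (simp add: monomials_def)
  next
    case (5 s)
    then show ?case by (simp add: monomial_value_def lookup_monomial_of)
  qed
  finally show ?thesis .
qed

text \<open>Petrie functions are homogeneous, so a single coefficient survives. For negative
  \<open>m\<close> the exponent \<open>nat m\<close> is 0, but the coefficient is 0 as well.\<close>

lemma graded_eval_petrie:
  assumes "k > 0"
  shows "graded_eval x N (petrie k m) = fps_const (nth_int (petrie_product x N k) m) * fps_X ^ nat m"
proof (rule fps_ext)
  fix n
  have "fps_nth (graded_eval x N (petrie k m)) n = (\<Sum>a\<in>monomials N n.
      if int n = m \<and> (\<forall>i\<in>Poly_Mapping.keys a. Poly_Mapping.lookup a i < k) then monomial_value x N a else 0)"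
    using assms by (auto simp: graded_eval_def petrie_coeff degree_eq_sum_keys simp del: of_nat_sum intro!: sum.cong)
  also have "\<dots> = (if int n = m then fps_nth (petrie_product x N k) n else 0)"
    using finite_monomials[of N n]
    by (auto simp: petrie_product_nth[OF assms] sum.inter_filter[symmetric])
  finally show "fps_nth (graded_eval x N (petrie k m)) n =
      fps_nth (fps_const (nth_int (petrie_product x N k) m) * fps_X ^ nat m) n"
    by (auto simp: nth_int_def)
qed

text \<open>In each Leibniz term the shifts \<open>- i\<close> and \<open>p i\<close> cancel over
  the permutation, so the degrees add up to \<open>sum_list lam\<close>. Terms with a negative index
  vanish, so truncation by \<open>nat\<close> does no harm.\<close>

lemma det_graded:
  "det (mat (length lam) (length lam) (\<lambda>(i, j). fps_const (nth_int F (int (lam ! i) - int i + int j)) *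
      fps_X ^ nat (int (lam ! i) - int i + int j))) =
    fps_const (jacobi_trudi F lam) * fps_X ^ sum_list lam"
proof -
  let ?l = "length lam" and ?d = "\<lambda>i j. int (lam ! i) - int i + int j"
  have prod: "(\<Prod>i=0..<?l. fps_const (nth_int F (?d i (p i))) * fps_X ^ nat (?d i (p i))) =
      fps_const (\<Prod>i=0..<?l. nth_int F (?d i (p i))) * fps_X ^ sum_list lam"
    if p: "p permutes {0..<?l}" for p
  proof (cases "\<forall>i<?l. 0 \<le> ?d i (p i)")
    case True
    have "int (\<Sum>i=0..<?l. nat (?d i (p i))) = (\<Sum>i=0..<?l. ?d i (p i))"
      using True by simp
    also have "\<dots> = (\<Sum>i=0..<?l. int (lam ! i)) - (\<Sum>i=0..<?l. int i) + (\<Sum>i=0..<?l. int (p i))"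
      by (simp add: sum.distrib sum_subtractf)
    also have "(\<Sum>i=0..<?l. int (p i)) = (\<Sum>i=0..<?l. int i)"
      using sum.permute[OF p, of int] by (simp add: comp_def)
    finally have "(\<Sum>i=0..<?l. nat (?d i (p i))) = sum_list lam"
      by (simp add: sum_list_sum_nth flip: of_nat_sum)
    then show ?thesis
      by (simp add: prod.distrib fps_const_prod flip: power_sum)
  next
    case False
    then obtain i where "i < ?l" "?d i (p i) < 0" by auto
    then have z: "i \<in> {0..<?l}" "nth_int F (?d i (p i)) = 0" by (auto simp: nth_int_def)
    have "(\<Prod>i=0..<?l. nth_int F (?d i (p i))) = 0"
      by (rule prod_zero) (use z in auto)
    moreover have "(\<Prod>i=0..<?l. fps_const (nth_int F (?d i (p i))) * fps_X ^ nat (?d i (p i))) = 0"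
      by (rule prod_zero) (use z in \<open>auto intro!: bexI[of _ i]\<close>)
    ultimately show ?thesis by simp
  qed
  have perm: "p i < ?l" if "p permutes {0..<?l}" "i < ?l" for p i
    using permutes_in_image[OF that(1), of i] that(2) by simp
  have "det (mat ?l ?l (\<lambda>(i, j). fps_const (nth_int F (?d i j)) * fps_X ^ nat (?d i j))) =
    (\<Sum>p | p permutes {0..<?l}. signof p *
      (\<Prod>i=0..<?l. fps_const (nth_int F (?d i (p i))) * fps_X ^ nat (?d i (p i))))"
    by (subst det_def'[of _ ?l]) (auto simp: perm intro!: sum.cong prod.cong)
  also have "\<dots> = (\<Sum>p | p permutes {0..<?l}. fps_const (signof p * (\<Prod>i=0..<?l. nth_int F (?d i (p i)))) * fps_X ^ sum_list lam)"
    by (rule sum.cong) (auto simp: prod mult.assoc simp flip: fps_const_mult fps_of_int)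
  also have "\<dots> = fps_const (jacobi_trudi F lam) * fps_X ^ sum_list lam"
    unfolding jacobi_trudi_def
    by (subst det_def'[of _ ?l]) (auto simp: perm simp flip: fps_const_sum sum_distrib_right intro!: sum.cong prod.cong arg_cong[where f = fps_const])
  finally show ?thesis .
qed

lemma graded_eval_modular_schur:
  assumes "k > 0"
  shows "graded_eval x N (modular_schur k lam) =
    fps_const (jacobi_trudi (petrie_product x N k) lam) * fps_X ^ sum_list lam"
proof -
  interpret comm_ring_hom "graded_eval x N" by (rule comm_ring_hom_graded_eval)
  show ?thesis
    unfolding modular_schur_def det_graded[symmetric] hom_det[symmetric]
    by (intro arg_cong[where f = det] eq_matI) (auto simp: graded_eval_petrie[OF assms])
qed

lemma card_diagram: "card (diagram lam) = sum_list lam"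
proof -
  have "diagram lam = (SIGMA i:{0..<length lam}. {..<lam ! i})" by auto
  then show ?thesis by (simp add: sum_list_sum_nth)
qed

lemma lookup_tableau_weight:
  "Poly_Mapping.lookup (tableau_weight lam T) i = (\<Sum>c\<in>diagram lam. if T c = i then 1 else 0)"
  by (simp add: tableau_weight_def lookup_sum lookup_single when_def cong: if_cong)

lemma tableau_weight_bounded:
  assumes "\<forall>c\<in>diagram lam. T c < N"
  shows "tableau_weight lam T \<in> monomials N (sum_list lam)"
    and "monomial_value x N (tableau_weight lam T) = (\<Prod>c\<in>diagram lam. x (T c))"
proof -
  have "(\<Sum>i<N. Poly_Mapping.lookup (tableau_weight lam T) i) = (\<Sum>c\<in>diagram lam. \<Sum>i<N. if T c = i then 1 else 0)"
    unfolding lookup_tableau_weight by (rule sum.swap)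
  also have "\<dots> = (\<Sum>c\<in>diagram lam. 1)" using assms by (intro sum.cong) auto
  finally have "(\<Sum>i<N. Poly_Mapping.lookup (tableau_weight lam T) i) = sum_list lam"
    by (simp add: card_diagram)
  moreover have "i < N" if "i \<in> Poly_Mapping.keys (tableau_weight lam T)" for i
  proof (rule ccontr)
    assume "\<not> i < N"
    then have "Poly_Mapping.lookup (tableau_weight lam T) i = 0"
      unfolding lookup_tableau_weight using assms by (intro sum.neutral) auto
    then show False using that by (simp add: in_keys_iff)
  qed
  ultimately show "tableau_weight lam T \<in> monomials N (sum_list lam)"
    by (auto simp: monomials_def)
  have "monomial_value x N (tableau_weight lam T) = (\<Prod>i<N. \<Prod>c\<in>diagram lam. if T c = i then x i else 1)"
    unfolding monomial_value_def lookup_tableau_weight power_sum by (intro prod.cong) auto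
  also have "\<dots> = (\<Prod>c\<in>diagram lam. \<Prod>i<N. if T c = i then x i else 1)"
    by (rule prod.swap)
  also have "\<dots> = (\<Prod>c\<in>diagram lam. x (T c))" using assms by (intro prod.cong) auto
  finally show "monomial_value x N (tableau_weight lam T) = (\<Prod>c\<in>diagram lam. x (T c))" .
qed

text \<open>The tableaux are grouped by weight; a weight in the first \<open>N\<close> variables
  forces all entries below \<open>N\<close>.\<close>

lemma graded_eval_schur: "fps_nth (graded_eval x N (schur lam)) (sum_list lam) = tableau_sum x N lam"
proof -
  let ?M = "monomials N (sum_list lam)" and ?w = "tableau_weight lam"
  have bd: "{T \<in> ssyt lam. ?w T = a} = {T \<in> bounded_ssyt N lam. ?w T = a}" if "a \<in> ?M" for a
  proof -
    have "T c < N" if "c \<in> diagram lam" "?w T = a" for T c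
    proof -
      have "Poly_Mapping.lookup (?w T) (T c) \<noteq> 0"
        using that(1) finite_diagram by (auto simp: lookup_tableau_weight)
      then show ?thesis using that \<open>a \<in> ?M\<close> by (auto simp: monomials_def in_keys_iff subset_iff)
    qed
    then show ?thesis by (auto simp: bounded_ssyt_def)
  qed
  have "fps_nth (graded_eval x N (schur lam)) (sum_list lam) =
      (\<Sum>a\<in>?M. \<Sum>T | T \<in> bounded_ssyt N lam \<and> ?w T = a. monomial_value x N (?w T))"
    by (auto simp: graded_eval_def schur_def MSeries_inverse bd intro!: sum.cong)
  also have "\<dots> = (\<Sum>T\<in>bounded_ssyt N lam. monomial_value x N (?w T))"
    by (rule sum.group[OF finite_bounded_ssyt finite_monomials])
       (auto simp: bounded_ssyt_def tableau_weight_bounded)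
  also have "\<dots> = tableau_sum x N lam"
    unfolding tableau_sum_def by (intro sum.cong) (auto simp: bounded_ssyt_def tableau_weight_bounded)
  finally show ?thesis .
qed

text \<open>Compares coefficients of degree \<open>sum_list lam\<close>. The later sections use the
  hypothesis on \<open>modular_schur\<close> in this form.\<close>

theorem jacobi_trudi_petrie_product:
  fixes x :: "nat \<Rightarrow> 'a::field"
  assumes "k > 0" "sorted_wrt (\<ge>) lam" "modular_schur k lam = schur lam"
  shows "jacobi_trudi (petrie_product x N k) lam = jacobi_trudi (\<Prod>i<N. inverse (linear_factor (x i))) lam"
proof -
  have "jacobi_trudi (petrie_product x N k) lam = fps_nth (graded_eval x N (modular_schur k lam)) (sum_list lam)"
    by (simp add: graded_eval_modular_schur[OF assms(1)])
  also have "\<dots> = tableau_sum x N lam" by (simp add: assms(3) graded_eval_schur)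
  finally show ?thesis by (simp add: jacobi_trudi_identity[OF assms(2)])
qed

section \<open>Norms of power series\<close>

definition agree_upto :: "nat \<Rightarrow> 'a::zero fps \<Rightarrow> 'a fps \<Rightarrow> bool" where
  "agree_upto n F G \<longleftrightarrow> (\<forall>i\<le>n. fps_nth F i = fps_nth G i)"

lemma agree_upto_refl: "agree_upto n F F"
  by (simp add: agree_upto_def)

lemma agree_upto_mult:
  fixes F G :: "'a::comm_ring_1 fps"
  assumes "agree_upto n F F'" "agree_upto n G G'"
  shows "agree_upto n (F * G) (F' * G')"
  using assms by (auto simp: agree_upto_def fps_mult_nth intro!: sum.cong)

lemma agree_upto_prod:
  fixes F G :: "'b \<Rightarrow> 'a::comm_ring_1 fps"
  assumes "\<And>i. i \<in> A \<Longrightarrow> agree_upto n (F i) (G i)"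
  shows "agree_upto n (\<Prod>i\<in>A. F i) (\<Prod>i\<in>A. G i)"
  using assms by (induction A rule: infinite_finite_induct) (auto intro: agree_upto_mult agree_upto_refl)

lemma agree_upto_inverse:
  fixes F G :: "'a::field fps"
  assumes "agree_upto n F G" "fps_nth F 0 \<noteq> 0"
  shows "agree_upto n (inverse F) (inverse G)"
proof -
  have "fps_nth G 0 \<noteq> 0" using assms by (auto simp: agree_upto_def)
  then have "agree_upto n (inverse F * G * inverse G) (inverse F)"
    by (simp add: mult.assoc inverse_mult_eq_1' agree_upto_refl)
  moreover have "agree_upto n (inverse F * F * inverse G) (inverse F * G * inverse G)"
    by (intro agree_upto_mult agree_upto_refl assms)
  ultimately show ?thesis
    using assms(2) by (simp add: inverse_mult_eq_1 agree_upto_def)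
qed

text \<open>An entry has index at most \<open>lam ! i + j\<close>, so the determinant depends only
  on a truncation of the series.\<close>

lemma jacobi_trudi_cong:
  assumes "agree_upto (sum_list lam + length lam) F G"
  shows "jacobi_trudi F lam = jacobi_trudi G lam"
proof -
  have "nth_int F (int (lam ! i) - int i + int j) = nth_int G (int (lam ! i) - int i + int j)"
    if "i < length lam" "j < length lam" for i j
  proof -
    have "lam ! i \<le> sum_list lam" using that by (simp add: member_le_sum_list)
    then show ?thesis using assms that by (auto simp: nth_int_def agree_upto_def)
  qed
  then show ?thesis
    unfolding jacobi_trudi_def by (intro arg_cong[where f = det] eq_matI) auto
qed

text \<open>Over an algebraically closed field the complete homogeneous functions take arbitrary values: the
  \<open>x i\<close> are the reciprocal roots of a truncation of \<open>1/F\<close>.\<close>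

lemma complete_homogeneous_realisation:
  fixes F :: "complex fps"
  assumes "fps_nth F 0 = 1"
  obtains x where "agree_upto N F (\<Prod>i<N. inverse (linear_factor (x i)))"
proof -
  define G where "G = inverse F"
  have G0: "fps_nth G 0 = 1" by (simp add: G_def assms)
  \<comment> \<open>The truncation of \<open>1/F\<close> with reversed coefficients. It is monic
    because \<open>G\<close> starts with 1, so it has exactly \<open>N\<close> roots with
    multiplicity even if the truncation has smaller degree.\<close>
  define q where "q = (\<Sum>n\<le>N. monom (fps_nth G (N - n)) n)"
  have q: "poly.coeff q n = (if n \<le> N then fps_nth G (N - n) else 0)" for n
    by (simp add: q_def coeff_sum)
  have deg: "degree q = N"
    by (rule antisym) (auto intro!: degree_le le_degree simp: q G0)
  obtain x where x: "smult (lead_coeff q) (\<Prod>i<degree q. [:- x i, 1:]) = q"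
    using complex_poly_decompose'[of q] .
  then have "q = (\<Prod>i<N. [:- x i, 1:])" by (simp add: deg q G0)
  moreover have "reflect_poly [:- c, 1:] = [:1, - c:]" for c :: complex
    by (rule poly_eqI) (auto simp: coeff_reflect_poly coeff_pCons split: nat.splits)
  ultimately have "fps_of_poly (reflect_poly q) = (\<Prod>i<N. linear_factor (x i))"
    by (simp add: reflect_poly_prod fps_of_poly_prod fps_of_poly_pCons flip: fps_const_neg)
  moreover have "agree_upto N G (fps_of_poly (reflect_poly q))"
    by (simp add: agree_upto_def coeff_reflect_poly deg q)
  ultimately have "agree_upto N (inverse G) (inverse (\<Prod>i<N. linear_factor (x i)))"
    using agree_upto_inverse[of N G] G0 by simp
  then show ?thesis
    using that[of x] assms by (simp add: G_def inverse_prod_fps)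
qed

section \<open>Dilations, roots of unity and the norm\<close>

definition dilate :: "complex \<Rightarrow> complex fps \<Rightarrow> complex fps" where
  "dilate c F = fps_compose F (fps_const c * fps_X)"

lemma dilate_nth [simp]: "fps_nth (dilate c F) n = c ^ n * fps_nth F n"
  by (simp add: dilate_def)

lemma dilate_mult: "dilate c (F * G) = dilate c F * dilate c G"
  by (simp add: dilate_def fps_compose_mult_distrib)

lemma dilate_prod: "dilate c (\<Prod>i\<in>A. F i) = (\<Prod>i\<in>A. dilate c (F i))"
  by (simp add: dilate_def fps_compose_prod_distrib)

lemma dilate_power: "dilate c (F ^ n) = dilate c F ^ n"
  by (simp add: dilate_def fps_compose_power)

lemma dilate_one [simp]: "dilate c 1 = 1"
  by (simp add: dilate_def)

lemma dilate_dilate: "dilate c (dilate d F) = dilate (c * d) F"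
  by (rule fps_ext) (simp add: power_mult_distrib)

lemma dilate_inverse:
  assumes "fps_nth F 0 = 1"
  shows "dilate c (inverse F) = inverse (dilate c F)"
proof -
  have "dilate c F * dilate c (inverse F) = 1"
    using assms by (simp add: inverse_mult_eq_1' flip: dilate_mult)
  then show ?thesis by (simp add: fps_inverse_unique)
qed

definition root_of_unity :: "nat \<Rightarrow> nat \<Rightarrow> complex" where
  "root_of_unity k j = cis (2 * pi * real j / real k)"

lemma root_of_unity_eq_power: "root_of_unity k j = root_of_unity k (Suc 0) ^ j"
  by (simp add: root_of_unity_def DeMoivre mult_ac)

lemma root_of_unity_power:
  assumes "k > 0" shows "root_of_unity k j ^ k = 1"
proof -
  have "root_of_unity k j ^ k = cis (2 * pi) ^ j"
    using assms by (simp add: root_of_unity_def DeMoivre mult_ac)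
  then show ?thesis by simp
qed

text \<open>Both sides have degree at most \<open>k\<close> in \<open>y\<close> and agree at 0 and
  at the \<open>k\<close> roots of unity.\<close>

lemma prod_roots_of_unity:
  assumes "k > 0"
  shows "(\<Prod>j<k. 1 - root_of_unity k j * y) = 1 - y ^ k"
proof -
  let ?p = "\<Prod>j<k. [:1, - root_of_unity k j:]" and ?q = "1 - monom 1 k :: complex poly"
  have bij: "bij_betw (root_of_unity k) {..<k} {z. z ^ k = 1}"
    using bij_betw_roots_unity[OF assms] unfolding root_of_unity_def .
  have "?p = ?q"
  proof (rule poly_eqI_degree[where A = "insert 0 {z. z ^ k = 1}"])
    fix z assume z: "z \<in> insert 0 {z :: complex. z ^ k = 1}"
    show "poly ?p z = poly ?q z"
    proof (cases "z = 0")
      case True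
      then show ?thesis using assms by (simp add: poly_prod poly_monom)
    next
      case False
      then have "z ^ k = 1" using z by simp
      then have "inverse z \<in> {z. z ^ k = 1}" by (simp add: power_inverse)
      then have "inverse z \<in> root_of_unity k ` {..<k}"
        using bij by (simp add: bij_betw_def)
      then obtain j where "j < k" "root_of_unity k j = inverse z" by force
      then have "poly ?p z = 0"
        using False by (auto simp: poly_prod intro!: bexI[of _ j])
      then show ?thesis using \<open>z ^ k = 1\<close> by (simp add: poly_monom)
    qed
  next
    have "card (insert 0 {z :: complex. z ^ k = 1}) = Suc k"
      using assms bij_betw_same_card[OF bij] by (simp add: finite_roots_unity power_0_left)
    moreover have "degree ?p \<le> k"
    proof -
      have "degree ?p \<le> (\<Sum>j<k. degree [:1, - root_of_unity k j:])"
        by (rule degree_prod_sum_le[unfolded comp_def]) simp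
      also have "\<dots> \<le> of_nat (card {..<k}) * 1"
        by (rule sum_bounded_above) (simp add: degree_pCons_eq_if)
      finally show ?thesis by simp
    qed
    moreover have "degree ?q \<le> k"
      by (rule degree_diff_le) (auto simp: degree_monom_le)
    ultimately show "degree ?p < card (insert 0 {z :: complex. z ^ k = 1})"
      "degree ?q < card (insert 0 {z :: complex. z ^ k = 1})" by simp_all
  qed
  then have "poly ?p y = poly ?q y" by simp
  then show ?thesis by (simp add: poly_prod poly_monom mult.commute)
qed

text \<open>The norm from \<open>\<complex>\<lbrakk>X\<rbrakk>\<close> to \<open>\<complex>\<lbrakk>X\<^sup>k\<rbrakk>\<close>.\<close>

definition fps_norm :: "nat \<Rightarrow> complex fps \<Rightarrow> complex fps" where
  "fps_norm k F = (\<Prod>j<k. dilate (root_of_unity k j) F)"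

lemma fps_norm_mult: "fps_norm k (F * G) = fps_norm k F * fps_norm k G"
  by (simp add: fps_norm_def dilate_mult prod.distrib)

lemma fps_norm_prod: "fps_norm k (\<Prod>i\<in>A. F i) = (\<Prod>i\<in>A. fps_norm k (F i))"
  unfolding fps_norm_def dilate_prod by (rule prod.swap)

lemma fps_norm_one [simp]: "fps_norm k 1 = 1"
  by (simp add: fps_norm_def)

lemma fps_norm_nth_0:
  assumes "fps_nth F 0 = 1" shows "fps_nth (fps_norm k F) 0 = 1"
proof -
  have "fps_nth (\<Prod>j<m. dilate (root_of_unity k j) F) 0 = 1" for m
    by (induction m) (simp_all add: assms)
  then show ?thesis by (simp add: fps_norm_def)
qed

lemma agree_upto_norm:
  assumes "agree_upto n F G" shows "agree_upto n (fps_norm k F) (fps_norm k G)"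
  unfolding fps_norm_def
  by (intro agree_upto_prod) (use assms in \<open>simp add: agree_upto_def\<close>)

lemma fps_norm_linear_factor:
  assumes "k > 0"
  shows "fps_norm k (linear_factor c) = 1 - (fps_const c * fps_X) ^ k"
proof -
  have dil: "dilate d (linear_factor c) = fps_of_poly [:1, - (d * c):]" for d
    by (rule fps_ext) (auto simp: coeff_pCons fps_X_nth split: nat.splits)
  have "(\<Prod>j<k. [:1, - (root_of_unity k j * c):]) = 1 - monom (c ^ k) k"
  proof (subst poly_eq_poly_eq_iff[symmetric], rule ext)
    fix y
    show "poly (\<Prod>j<k. [:1, - (root_of_unity k j * c):]) y = poly (1 - monom (c ^ k) k) y"
      using prod_roots_of_unity[OF assms, of "c * y"]
      by (simp add: poly_prod poly_monom mult_ac power_mult_distrib)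
  qed
  then have "fps_norm k (linear_factor c) = fps_of_poly (1 - monom (c ^ k) k)"
    unfolding fps_norm_def dil by (simp flip: fps_of_poly_prod)
  then show ?thesis
    by (simp add: fps_of_poly_diff fps_of_poly_monom power_mult_distrib)
qed

text \<open>Each factor is a finite geometric series, the quotient of \<open>1 - (c X) ^ k\<close>
  by \<open>1 - c X\<close>, and the numerator is the norm of the denominator.\<close>

lemma petrie_product_eq_norm_quotient:
  fixes x :: "nat \<Rightarrow> complex" and N :: nat
  assumes "k > 0"
  defines "H \<equiv> \<Prod>i<N. inverse (linear_factor (x i))"
  shows "petrie_product x N k = H * inverse (fps_norm k H)"
proof -
  have factor: "(\<Sum>j<k. (fps_const c * fps_X) ^ j) * fps_norm k (inverse (linear_factor c)) =
      inverse (linear_factor c)" for c :: complex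
  proof -
    let ?L = "linear_factor c" and ?S = "\<Sum>j<k. (fps_const c * fps_X) ^ j"
    have inv: "inverse ?L * ?L = 1" by (rule linear_factor_inverse)
    have "?L * ?S = fps_norm k ?L"
      unfolding fps_norm_linear_factor[OF assms(1)] by (rule one_diff_power_eq[symmetric])
    then have "?L * ?S * fps_norm k (inverse ?L) = 1"
      using inv by (simp add: mult.commute flip: fps_norm_mult)
    then have "inverse ?L * (?L * ?S * fps_norm k (inverse ?L)) = inverse ?L" by simp
    then have "(inverse ?L * ?L) * (?S * fps_norm k (inverse ?L)) = inverse ?L" by (simp only: mult_ac)
    then show ?thesis unfolding inv by simp
  qed
  have "petrie_product x N k * fps_norm k H = H"
    by (simp add: petrie_product_def H_def fps_norm_prod factor flip: prod.distrib)
  moreover have "fps_nth H 0 = 1"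
    unfolding H_def by (induction N) simp_all
  then have "fps_norm k H * inverse (fps_norm k H) = 1"
    by (intro inverse_mult_eq_1') (simp add: fps_norm_nth_0)
  ultimately show ?thesis by (metis mult.assoc mult.right_neutral)
qed

section \<open>Splitting a series into a part of norm 1 and an invariant part\<close>

lemma root_of_unity_add: "root_of_unity k i * root_of_unity k j = root_of_unity k (i + j)"
  by (simp add: root_of_unity_def cis_mult add_divide_distrib ring_distribs)

text \<open>The dilation shifts the factors of the norm cyclically.\<close>

lemma dilate_fps_norm: "dilate (root_of_unity k (Suc 0)) (fps_norm k F) = fps_norm k F"
proof (cases k)
  case (Suc m)
  let ?f = "\<lambda>j. dilate (root_of_unity k j) F"
  have "?f (Suc m) = ?f 0" using Suc by (simp add: root_of_unity_def)
  then have "(\<Prod>j<Suc m. ?f (Suc j)) = (\<Prod>j<Suc m. ?f j)"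
    unfolding prod.lessThan_Suc_shift[of ?f m] by (simp add: mult.commute)
  then show ?thesis
    unfolding fps_norm_def dilate_prod dilate_dilate root_of_unity_add by (simp add: Suc)
qed (simp add: fps_norm_def)

lemma fps_norm_invariant:
  assumes "dilate (root_of_unity k (Suc 0)) A = A"
  shows "fps_norm k A = A ^ k"
proof -
  have "dilate (root_of_unity k j) A = A" for j
  proof (induction j)
    case 0
    show ?case by (rule fps_ext) (simp add: root_of_unity_def)
  next
    case (Suc j)
    then show ?case
      using assms by (metis dilate_dilate root_of_unity_add add_Suc add_0)
  qed
  then show ?thesis by (simp add: fps_norm_def)
qed

text \<open>\<open>A\<close> is the \<open>k\<close>-th root of the norm of \<open>F\<close> with
  constant term 1. By uniqueness of that root it inherits the invariance of the norm, so its own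
  norm is \<open>A ^ k\<close>, and dividing it out of \<open>F\<close> leaves norm 1.\<close>

lemma fps_norm_decomposition:
  assumes "k > 0" "fps_nth F 0 = 1"
  obtains H A where "F = H * A" "fps_norm k H = 1" "fps_nth H 0 = 1" "fps_nth A 0 = 1"
    "dilate (root_of_unity k (Suc 0)) A = A"
proof -
  obtain m where k: "k = Suc m" using assms(1) by (cases k) auto
  \<comment> \<open>\<open>?r\<close> selects 1 as the \<open>k\<close>-th root of the constant term
    1.\<close>
  let ?r = "\<lambda>_ _. 1 :: complex"
  define A where "A = fps_radical ?r k (fps_norm k F)"
  have n0: "fps_nth (fps_norm k F) 0 = 1" by (simp add: fps_norm_nth_0 assms)
  have unique: "B ^ k = fps_norm k F \<longleftrightarrow> B = A" if "fps_nth B 0 = 1" for B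
    unfolding A_def k by (rule radical_unique) (use n0 that k in auto)
  have A0: "fps_nth A 0 = 1" using k by (simp add: A_def)
  then have Ak: "A ^ k = fps_norm k F" using unique by simp
  have inv: "dilate (root_of_unity k (Suc 0)) A = A"
    using unique[of "dilate (root_of_unity k (Suc 0)) A"] A0 Ak by (simp add: dilate_fps_norm flip: dilate_power)
  define H where "H = F * inverse A"
  have "F = H * A"
    using A0 by (simp add: H_def mult.assoc inverse_mult_eq_1)
  moreover from this have "fps_norm k F = fps_norm k H * fps_norm k F"
    using Ak fps_norm_invariant[OF inv] by (metis fps_norm_mult)
  then have "fps_norm k H = 1" using n0 by (metis fps_nonzeroI mult_cancel_right1 zero_neq_one)
  moreover have "fps_nth H 0 = 1" using A0 assms by (simp add: H_def)
  ultimately show ?thesis using that A0 inv by blast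
qed

text \<open>With \<open>A = 1 + B\<close> and \<open>B\<close> divisible by \<open>X\<close>, the
  coefficient at \<open>m\<close> involves only \<open>n choose i\<close> with
  \<open>i \<le> m\<close>, each a polynomial in \<open>n\<close>; so the determinant is one
  too.\<close>

lemma jacobi_trudi_power_polynomial:
  fixes H A :: "complex fps"
  assumes "fps_nth A 0 = 1"
  obtains q where "\<And>n. jacobi_trudi (H * A ^ n) lam = poly q (of_nat n)"
proof -
  define B where "B = A - 1"
  have A: "A = B + 1" and B0: "fps_nth B 0 = 0" using assms by (simp_all add: B_def)
  have nth: "fps_nth (H * A ^ n) m = (\<Sum>i\<le>m. of_nat (n choose i) * fps_nth (H * B ^ i) m)" for n m
  proof -
    have "H * A ^ n = (\<Sum>i\<le>n. of_nat (n choose i) * (H * B ^ i))"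
      unfolding A binomial_ring by (simp add: sum_distrib_left mult_ac)
    then have "fps_nth (H * A ^ n) m = (\<Sum>i\<le>n. of_nat (n choose i) * fps_nth (H * B ^ i) m)"
      by (simp add: fps_sum_nth fps_of_nat[symmetric] del: fps_of_nat)
    also have "\<dots> = (\<Sum>i\<le>max n m. of_nat (n choose i) * fps_nth (H * B ^ i) m)"
      by (rule sum.mono_neutral_left) auto
    also have "\<dots> = (\<Sum>i\<le>m. of_nat (n choose i) * fps_nth (H * B ^ i) m)"
    proof (rule sum.mono_neutral_right)
      have "fps_nth (H * B ^ i) m = 0" if "m < i" for i
        using that startsby_zero_power_prefix[OF B0, of i] by (auto simp: fps_mult_nth intro!: sum.neutral)
      then show "\<forall>i\<in>{..max n m} - {..m}. of_nat (n choose i) * fps_nth (H * B ^ i) m = 0" by auto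
    qed auto
    finally show ?thesis .
  qed
  \<comment> \<open>The product is the falling factorial, which over \<open>fact i\<close> is the
    binomial coefficient as a polynomial.\<close>
  define c where "c m = (\<Sum>i\<le>m. smult (fps_nth (H * B ^ i) m / fact i) (\<Prod>l=0..<i. [:- of_nat l, 1:]))" for m
  have c: "fps_nth (H * A ^ n) m = poly (c m) (of_nat n)" for n m
    unfolding nth c_def binomial_gbinomial gbinomial_prod_rev
    by (simp add: poly_sum poly_prod mult_ac)
  let ?l = "length lam" and ?d = "\<lambda>i j. int (lam ! i) - int i + int j"
  define q where "q = det (mat ?l ?l (\<lambda>(i, j). if ?d i j < 0 then 0 else c (nat (?d i j))))"
  have "jacobi_trudi (H * A ^ n) lam = poly q (of_nat n)" for n
  proof -
    interpret comm_ring_hom "\<lambda>p. poly p (of_nat n :: complex)" by unfold_locales auto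
    show ?thesis
      unfolding jacobi_trudi_def q_def hom_det[symmetric]
      by (intro arg_cong[where f = det] eq_matI) (auto simp: nth_int_def c)
  qed
  then show ?thesis using that by blast
qed

text \<open>Carries the identity from finitely many variables to every series with constant term
  1.\<close>

lemma jacobi_trudi_norm_quotient:
  assumes k: "k > 0" and F0: "fps_nth F 0 = 1"
    and petrie: "\<And>x N. jacobi_trudi (petrie_product x N k) lam =
      jacobi_trudi (\<Prod>i<N. inverse (linear_factor (x i :: complex))) lam"
  shows "jacobi_trudi (F * inverse (fps_norm k F)) lam = jacobi_trudi F lam"
proof -
  let ?N = "sum_list lam + length lam"
  obtain x where x: "agree_upto ?N F (\<Prod>i<?N. inverse (linear_factor (x i)))" (is "agree_upto _ _ ?H")
    using complete_homogeneous_realisation[OF F0] .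
  have "jacobi_trudi (F * inverse (fps_norm k F)) lam = jacobi_trudi (?H * inverse (fps_norm k ?H)) lam"
    using x F0 by (intro jacobi_trudi_cong agree_upto_mult agree_upto_inverse agree_upto_norm)
       (simp_all add: fps_norm_nth_0)
  also have "\<dots> = jacobi_trudi ?H lam"
    using petrie[of x ?N] by (simp add: petrie_product_eq_norm_quotient[OF k])
  also have "\<dots> = jacobi_trudi F lam" by (rule jacobi_trudi_cong[OF x, symmetric])
  finally show ?thesis .
qed

text \<open>With \<open>m = k - 1\<close>, the determinant of \<open>H * A ^ n\<close> takes one
  value at all \<open>n = (m * m) ^ r\<close>. Being polynomial in \<open>n\<close> it is constant,
  and \<open>n = 1\<close> and \<open>n = 0\<close> are compared.\<close>

lemma jacobi_trudi_norm_one: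
  assumes k: "k > 2" and H: "fps_norm k H = 1" "fps_nth H 0 = 1"
    and A: "dilate (root_of_unity k (Suc 0)) A = A" "fps_nth A 0 = 1"
    and petrie: "\<And>x N. jacobi_trudi (petrie_product x N k) lam =
      jacobi_trudi (\<Prod>i<N. inverse (linear_factor (x i :: complex))) lam"
  shows "jacobi_trudi (H * A) lam = jacobi_trudi H lam"
proof -
  obtain m where m: "k = Suc m" using k by (cases k) auto
  \<comment> \<open>As \<open>H\<close> has norm 1, the norm of \<open>H * B\<close> is
    \<open>B ^ k\<close>, and dividing by it replaces \<open>B\<close> by its power with exponent
    \<open>1 - k = - m\<close>.\<close>
  have step: "jacobi_trudi (H * B) lam = jacobi_trudi (H * inverse B ^ m) lam"
    if B: "dilate (root_of_unity k (Suc 0)) B = B" "fps_nth B 0 = 1" for B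
  proof -
    have "fps_norm k (H * B) = B ^ k"
      by (simp add: fps_norm_mult H fps_norm_invariant[OF B(1)])
    moreover have "B * inverse B = 1" using B(2) by (simp add: inverse_mult_eq_1')
    moreover have "H * B * inverse (B ^ k) = H * ((B * inverse B) * inverse B ^ m)"
      by (simp add: m fps_inverse_mult fps_inverse_power mult_ac)
    ultimately have eq: "H * B * inverse (fps_norm k (H * B)) = H * inverse B ^ m" by simp
    have "jacobi_trudi (H * B * inverse (fps_norm k (H * B))) lam = jacobi_trudi (H * B) lam"
      by (rule jacobi_trudi_norm_quotient[OF _ _ petrie]) (use k H(2) B(2) in simp_all)
    then show ?thesis unfolding eq by simp
  qed
  \<comment> \<open>Two steps multiply the exponent by the square of \<open>- m\<close>, so it stays
    a natural number.\<close>
  let ?e = "m * m"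
  have inv_pow: "dilate (root_of_unity k (Suc 0)) (A ^ n) = A ^ n" "fps_nth (A ^ n) 0 = 1" for n
    using A by (simp_all add: dilate_power fps_nth_power_0)
  have double_step: "jacobi_trudi (H * A ^ n) lam = jacobi_trudi (H * A ^ (n * ?e)) lam" for n
  proof -
    let ?B = "inverse (A ^ n) ^ m"
    have "jacobi_trudi (H * A ^ n) lam = jacobi_trudi (H * ?B) lam"
      by (rule step) (rule inv_pow)+
    also have "\<dots> = jacobi_trudi (H * inverse ?B ^ m) lam"
      by (rule step) (simp_all add: dilate_power dilate_inverse[OF inv_pow(2), unfolded dilate_power] A fps_nth_power_0)
    also have "inverse ?B ^ m = A ^ (n * ?e)"
      using inv_pow(2)[of "n * ?e"] by (simp add: fps_inverse_power[symmetric] mult.assoc flip: power_mult)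
    finally show ?thesis .
  qed
  have iterate: "jacobi_trudi (H * A ^ (?e ^ r)) lam = jacobi_trudi (H * A) lam" for r
  proof (induction r)
    case (Suc r)
    then show ?case using double_step[of "?e ^ r"] by (simp add: mult.commute)
  qed simp
  obtain q where q: "\<And>n. jacobi_trudi (H * A ^ n) lam = poly q (of_nat n)"
    using jacobi_trudi_power_polynomial[OF A(2)] by blast
  let ?p = "q - [:jacobi_trudi (H * A) lam:]"
  \<comment> \<open>Here \<open>k > 2\<close> enters: the exponents \<open>?e ^ r\<close> are
    distinct, giving infinitely many roots of \<open>?p\<close>.\<close>
  have "1 < ?e" using k m by (cases m) auto
  then have "inj (\<lambda>r. of_nat (?e ^ r) :: complex)"
    by (intro injI) (simp only: of_nat_eq_iff power_inject_exp)
  then have "infinite (range (\<lambda>r. of_nat (?e ^ r) :: complex))"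
    using finite_imageD[of _ UNIV] by auto
  moreover have "range (\<lambda>r. of_nat (?e ^ r) :: complex) \<subseteq> {z. poly ?p z = 0}"
    using iterate by (auto simp: q simp del: of_nat_power)
  ultimately have "?p = 0"
    using poly_roots_finite[of ?p] finite_subset by blast
  then have "poly q (of_nat 0) = jacobi_trudi (H * A) lam" by simp
  then show ?thesis using q[of 0] by simp
qed

theorem jacobi_trudi_invariant_factor:
  assumes k: "k > 2" and F: "fps_nth F 0 = 1"
    and B: "dilate (root_of_unity k (Suc 0)) B = B" "fps_nth B 0 = 1"
    and petrie: "\<And>x N. jacobi_trudi (petrie_product x N k) lam =
      jacobi_trudi (\<Prod>i<N. inverse (linear_factor (x i :: complex))) lam"
  shows "jacobi_trudi (F * B) lam = jacobi_trudi F lam"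
proof -
  have "0 < k" using k by simp
  then obtain H A where HA: "F = H * A" "fps_norm k H = 1" "fps_nth H 0 = 1" "fps_nth A 0 = 1"
    "dilate (root_of_unity k (Suc 0)) A = A"
    using fps_norm_decomposition[OF _ F] by blast
  have "jacobi_trudi (H * (A * B)) lam = jacobi_trudi H lam"
    by (rule jacobi_trudi_norm_one[OF k HA(2,3) _ _ petrie]) (simp_all add: dilate_mult HA B)
  moreover have "jacobi_trudi (H * A) lam = jacobi_trudi H lam"
    by (rule jacobi_trudi_norm_one[OF k HA(2,3) HA(5,4) petrie])
  ultimately show ?thesis by (simp add: HA(1) mult.assoc)
qed

section \<open>Alternants\<close>

lemma det_mat_swap:
  "det (mat n n (\<lambda>(i, j). f i j)) = det (mat n n (\<lambda>(i, j). f j i :: 'a::comm_ring_1))"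
proof -
  have "mat n n (\<lambda>(i, j). f j i) = transpose_mat (mat n n (\<lambda>(i, j). f i j))"
    by (rule eq_matI) auto
  then show ?thesis using det_transpose[of "mat n n (\<lambda>(i, j). f i j)" n] by simp
qed

text \<open>Orthogonality of characters: the weights extract the coefficient at \<open>g\<close> of
  a polynomial of degree below \<open>W\<close> from its values at the \<open>W\<close>-th roots of
  unity. The exponent \<open>W - g\<close> stands for \<open>- g\<close>.\<close>

lemma sum_roots_of_unity:
  assumes "e < W" "g < W"
  shows "(\<Sum>t<W. root_of_unity W t ^ (W - g) / of_nat W * root_of_unity W t ^ e) = (if e = g then 1 else 0)"
proof -
  let ?z = "root_of_unity W (Suc 0)" and ?n = "W - g + e"
  have W: "0 < W" using assms by simp
  have zW: "?z ^ W = 1" using root_of_unity_power[OF W] .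
  have inj: "inj_on (root_of_unity W) {..<W}"
    using bij_betw_roots_unity[OF W] unfolding root_of_unity_def bij_betw_def by blast
  have ne1: "?z ^ m \<noteq> 1" if "0 < m" "m < W" for m
    using inj_onD[OF inj, of m 0] that W root_of_unity_eq_power[of W m] by (auto simp: root_of_unity_def)
  have z1: "?z ^ ?n = 1 \<longleftrightarrow> e = g"
  proof (cases e g rule: linorder_cases)
    case less
    then show ?thesis using ne1[of ?n] assms by auto
  next
    case equal
    then show ?thesis using assms by (simp add: zW)
  next
    case greater
    then have "?n = W + (e - g)" using assms by simp
    then have "?z ^ ?n = ?z ^ (e - g)" by (simp add: power_add zW)
    then show ?thesis using ne1[of "e - g"] greater assms by auto
  qed
  have "(\<Sum>t<W. root_of_unity W t ^ (W - g) / of_nat W * root_of_unity W t ^ e) = (\<Sum>t<W. (?z ^ ?n) ^ t) / of_nat W"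
    unfolding sum_divide_distrib
  proof (rule sum.cong[OF refl])
    fix t
    have "root_of_unity W t ^ (W - g) * root_of_unity W t ^ e = (?z ^ ?n) ^ t"
      unfolding root_of_unity_eq_power[of W t] power_add[symmetric] power_mult[symmetric]
      by (simp add: distrib_left mult.commute)
    then show "root_of_unity W t ^ (W - g) / of_nat W * root_of_unity W t ^ e = (?z ^ ?n) ^ t / of_nat W"
      by simp
  qed
  also have "\<dots> = (if e = g then 1 else 0)"
  proof (cases "e = g")
    case True
    then show ?thesis using z1 W by simp
  next
    case False
    moreover have "(?z ^ ?n) ^ W = 1"
      by (metis zW power_mult mult.commute power_one)
    ultimately show ?thesis using z1 by (simp add: geometric_sum)
  qed
  finally show ?thesis .
qed

text \<open>Both alternants are compared through the coefficient of the monomial whose exponents are the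
  \<open>b i\<close> with \<open>b i\<^sub>0\<close> replaced by \<open>b i\<^sub>0 - k\<close>; coefficients are finite Fourier combinations of values.\<close>

lemma alternant_shift_exponents:
  fixes b :: "nat \<Rightarrow> nat"
  assumes dec: "\<And>i j. i < j \<Longrightarrow> j < l \<Longrightarrow> b j < b i" and k: "k > 0"
    and eq: "\<And>x :: nat \<Rightarrow> complex.
      det (mat l l (\<lambda>(i, r). x r ^ b i + (if k \<le> b i then x r ^ (b i - k) else 0))) =
      det (mat l l (\<lambda>(i, r). x r ^ b i))"
    and i0: "i0 < l" "k \<le> b i0"
  shows "\<exists>j<l. b j = b i0 - k"
proof (rule ccontr)
  assume no: "\<not> (\<exists>j<l. b j = b i0 - k)"
  \<comment> \<open>Larger than every exponent that occurs.\<close>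
  define W where "W = Suc (\<Sum>i<l. b i)"
  have bW: "b i < W" if "i < l" for i
    using that member_le_sum[of i "{..<l}" b] by (simp add: W_def less_Suc_eq_le)
  define g where "g r = (if r = i0 then b i0 - k else b r)" for r
  have gW: "g r < W" if "r < l" for r
    using bW[OF that] bW[OF i0(1)] by (auto simp: g_def intro: less_imp_diff_less)
  define c where "c r t = root_of_unity W t ^ (W - g r) / of_nat W" for r t
  have eq': "det (mat l l (\<lambda>(r, i). x r ^ b i + (if k \<le> b i then x r ^ (b i - k) else 0))) =
      det (mat l l (\<lambda>(r, i). x r ^ b i))" for x :: "nat \<Rightarrow> complex"
    using eq[of x] det_mat_swap[of l "\<lambda>r i. x r ^ b i + (if k \<le> b i then x r ^ (b i - k) else 0)"]
      det_mat_swap[of l "\<lambda>r i. x r ^ b i"] by simp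
  let ?f = "\<lambda>y i. y ^ b i + (if k \<le> b i then y ^ (b i - k) else 0) :: complex"
  \<comment> \<open>Row \<open>r\<close> holds the coefficients of \<open>x r ^ g r\<close> in the
    entries of the alternants, so the determinants of \<open>?M\<close> and \<open>?N\<close> are
    the coefficients of the whole monomial.\<close>
  let ?M = "mat l l (\<lambda>(r, i). (if b i = g r then 1 else 0) + (if k \<le> b i \<and> b i - k = g r then 1 else 0 :: complex))"
  let ?N = "mat l l (\<lambda>(r, i). if b i = g r then 1 else 0 :: complex)"
  have sums: "det (mat l l (\<lambda>(r, i). \<Sum>t<W. c r t * f (root_of_unity W t) i)) =
      (\<Sum>s\<in>PiE {0..<l} (\<lambda>_. {..<W}). (\<Prod>r=0..<l. c r (s r)) *
        det (mat l l (\<lambda>(r, i). f (root_of_unity W (s r)) i)))" for f :: "complex \<Rightarrow> nat \<Rightarrow> complex"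
    using det_rows_sum[where n = l and S = "\<lambda>_. {..<W}" and w = c and f = "\<lambda>r t i. f (root_of_unity W t) i"]
    by simp
  have coef: "(\<Sum>t<W. c r t * root_of_unity W t ^ e) = (if e = g r then 1 else 0)" if "e < W" "r < l" for e r
    unfolding c_def by (rule sum_roots_of_unity[OF that(1) gW[OF that(2)]])
  have "?M = mat l l (\<lambda>(r, i). \<Sum>t<W. c r t * ?f (root_of_unity W t) i)"
  proof (rule cong_mat)
    fix r i assume "r < l" "i < l"
    then show "(case (r, i) of (r, i) \<Rightarrow> (if b i = g r then 1 else 0) + (if k \<le> b i \<and> b i - k = g r then 1 else 0)) =
        (case (r, i) of (r, i) \<Rightarrow> \<Sum>t<W. c r t * ?f (root_of_unity W t) i)"
      using coef[of "b i" r] coef[of "b i - k" r] bW[of i]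
      by (cases "k \<le> b i") (simp_all add: distrib_left sum.distrib less_imp_diff_less)
  qed auto
  moreover have "?N = mat l l (\<lambda>(r, i). \<Sum>t<W. c r t * (root_of_unity W t) ^ b i)"
    by (rule cong_mat) (auto simp: coef[OF bW])
  moreover have "det (mat l l (\<lambda>(r, i). ?f (root_of_unity W (s r)) i)) =
      det (mat l l (\<lambda>(r, i). root_of_unity W (s r) ^ b i))" for s
    by (rule eq')
  ultimately have dets: "det ?M = det ?N"
    using sums[of ?f] sums[of "\<lambda>y i. y ^ b i"] by simp
  have inj: "b i = b j \<longleftrightarrow> i = j" if "i < l" "j < l" for i j
    using dec[of i j] dec[of j i] that by (cases i j rule: linorder_cases) auto
  have "det ?N = 0"
    by (rule det_zero_row[of _ l i0]) (use no i0 in \<open>auto simp: g_def\<close>)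
  moreover have "det ?M = 1"
  proof -
    \<comment> \<open>On the diagonal exactly one of the two exponents matches, the shifted one only
      in row \<open>i0\<close>. To the right of it the exponents are too small, and in row
      \<open>i0\<close> the assumption \<open>no\<close> and the injectivity of \<open>b\<close>
      exclude a match.\<close>
    have "det ?M = prod_list (diag_mat ?M)"
    proof (rule det_lower_triangular)
      fix r i assume ri: "r < i" "i < l"
      then have "b i < b r" using dec by simp
      moreover have "b i \<noteq> b i0 - k" using no ri by auto
      moreover have "k \<le> b i \<and> b i - k = b i0 - k \<longrightarrow> i = i0"
        using inj[of i i0] ri i0 by auto
      ultimately show "?M $$ (r, i) = 0" using ri k by (auto simp: g_def)
    qed simp
    also have "\<dots> = 1"
      unfolding prod_list_diag_prod by (rule prod.neutral) (use i0 k in \<open>auto simp: g_def\<close>)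
    finally show ?thesis .
  qed
  ultimately show False using dets by simp
qed

section \<open>The bialternant form of Jacobi-Trudi determinants\<close>

lemma linear_factor_prod_nth_eq_0:
  fixes x :: "'b \<Rightarrow> 'a::comm_ring_1"
  assumes "finite A" "card A < n"
  shows "fps_nth (\<Prod>s\<in>A. linear_factor (x s)) n = 0"
  using assms
proof (induction A arbitrary: n rule: finite_induct)
  case (insert a A)
  have "(1 - fps_const c * fps_X) * G = G - fps_const c * (fps_X * G)" for c and G :: "'a fps"
    by (simp add: algebra_simps)
  then show ?case
    using insert by (cases n) simp_all
qed simp

text \<open>\<open>E\<close> has degree below \<open>l\<close>, so \<open>l\<close> terms suffice;
  they are listed in the order of the columns of the Jacobi-Trudi matrix.\<close>

lemma convolution_nth_int:
  fixes G E :: "'a::comm_ring_1 fps"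
  assumes "\<And>n. l \<le> n \<Longrightarrow> fps_nth E n = 0" "0 < l"
  shows "(\<Sum>j<l. nth_int G (int b - int (l - Suc j)) * fps_nth E (l - Suc j)) = fps_nth (G * E) b"
proof -
  have "(\<Sum>j<l. nth_int G (int b - int (l - Suc j)) * fps_nth E (l - Suc j)) =
      (\<Sum>q<l. nth_int G (int b - int q) * fps_nth E q)"
    by (rule sum.nat_diff_reindex)
  also have "\<dots> = (\<Sum>q<max l (Suc b). nth_int G (int b - int q) * fps_nth E q)"
    by (rule sum.mono_neutral_left) (use assms in auto)
  also have "\<dots> = (\<Sum>q=0..b. nth_int G (int b - int q) * fps_nth E q)"
    by (rule sum.mono_neutral_right) (auto simp: nth_int_def)
  also have "\<dots> = (\<Sum>q=0..b. fps_nth E q * fps_nth G (b - q))"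
    by (rule sum.cong) (auto simp: nth_int_def nat_diff_distrib' mult.commute)
  also have "\<dots> = fps_nth (G * E) b"
    by (simp add: fps_mult_nth mult.commute[of G])
  finally show ?thesis .
qed

definition beta_number :: "nat list \<Rightarrow> nat \<Rightarrow> nat" where
  "beta_number lam i = lam ! i + (length lam - Suc i)"

text \<open>Column \<open>r\<close> of the second matrix comes from the linear factors of all
  variables but \<open>x r\<close>; multiplication cancels these and leaves
  \<open>B / (1 - x r X)\<close>. That matrix does not involve \<open>B\<close>, so equal
  Jacobi-Trudi determinants give equal right sides without division, even if values of
  \<open>x\<close> coincide.\<close>

lemma jacobi_trudi_bialternant:
  fixes x :: "nat \<Rightarrow> 'a::field" and B :: "'a fps" and lam :: "nat list"
  defines "l \<equiv> length lam"
  shows "jacobi_trudi ((\<Prod>s<l. inverse (linear_factor (x s))) * B) lam *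
      det (mat l l (\<lambda>(j, r). fps_nth (\<Prod>s\<in>{..<l} - {r}. linear_factor (x s)) (l - Suc j))) =
    det (mat l l (\<lambda>(i, r). fps_nth (inverse (linear_factor (x r)) * B) (beta_number lam i)))"
    (is "jacobi_trudi ?G lam * det ?M = det ?R")
proof -
  let ?A = "mat l l (\<lambda>(i, j). nth_int ?G (int (lam ! i) - int i + int j))"
  let ?E = "\<lambda>r. \<Prod>s\<in>{..<l} - {r}. linear_factor (x s)"
  have cancel: "?G * ?E r = inverse (linear_factor (x r)) * B" if "r < l" for r
  proof -
    have "(\<Prod>s\<in>{..<l} - {r}. inverse (linear_factor (x s))) * ?E r = 1"
      by (simp add: linear_factor_inverse flip: prod.distrib)
    moreover have "(\<Prod>s<l. inverse (linear_factor (x s))) =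
        inverse (linear_factor (x r)) * (\<Prod>s\<in>{..<l} - {r}. inverse (linear_factor (x s)))"
      using that by (intro prod.remove) auto
    ultimately show ?thesis by (simp add: mult_ac)
  qed
  have "?A * ?M = ?R"
  proof (rule eq_matI)
    fix i r assume "i < dim_row ?R" "r < dim_col ?R"
    then have i: "i < l" and r: "r < l" by auto
    have "(?A * ?M) $$ (i, r) = (\<Sum>j<l. nth_int ?G (int (lam ! i) - int i + int j) * fps_nth (?E r) (l - Suc j))"
      using i r by (simp add: scalar_prod_def atLeast0LessThan)
    also have "\<dots> = (\<Sum>j<l. nth_int ?G (int (beta_number lam i) - int (l - Suc j)) * fps_nth (?E r) (l - Suc j))"
      using i by (intro sum.cong refl arg_cong2[where f = "(*)"] arg_cong[where f = "nth_int ?G"])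
        (auto simp: beta_number_def l_def)
    also have "\<dots> = fps_nth (?G * ?E r) (beta_number lam i)"
      using r by (intro convolution_nth_int linear_factor_prod_nth_eq_0) auto
    also have "\<dots> = fps_nth (inverse (linear_factor (x r)) * B) (beta_number lam i)"
      by (simp only: cancel[OF r])
    finally show "(?A * ?M) $$ (i, r) = ?R $$ (i, r)" using i r by simp
  qed auto
  then have "det ?A * det ?M = det ?R"
    using det_mult[of ?A l ?M] by simp
  then show ?thesis by (simp add: jacobi_trudi_def l_def)
qed

lemma inverse_linear_factor: "inverse (linear_factor c) = Abs_fps (\<lambda>n. (c::'a::field) ^ n)"
proof (rule fps_inverse_unique)
  have "linear_factor c * F = F - fps_const c * (fps_X * F)" for F :: "'a fps"
    by (simp add: algebra_simps)
  then show "linear_factor c * Abs_fps (\<lambda>n. c ^ n) = 1"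
    by (intro fps_ext) (auto simp: power_eq_if)
qed

text \<open>The invariant factor is \<open>1 + X ^ k\<close>, which adds
  \<open>x r ^ (b - k)\<close> to the entry \<open>x r ^ b\<close> whenever
  \<open>k \<le> b\<close>.\<close>

theorem beta_number_shift:
  assumes k: "k > 2" and lam: "sorted_wrt (\<ge>) lam"
    and petrie: "\<And>x N. jacobi_trudi (petrie_product x N k) lam =
      jacobi_trudi (\<Prod>i<N. inverse (linear_factor (x i :: complex))) lam"
    and i: "i < length lam" "k \<le> beta_number lam i"
  shows "\<exists>j<length lam. beta_number lam j = beta_number lam i - k"
proof (rule alternant_shift_exponents[where b = "beta_number lam", OF _ _ _ i])
  fix i j assume ij: "i < j" "j < length lam"
  then have "lam ! j \<le> lam ! i" using lam by (simp add: sorted_wrt_iff_nth_less)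
  then show "beta_number lam j < beta_number lam i" using ij by (simp add: beta_number_def)
next
  fix x :: "nat \<Rightarrow> complex"
  let ?l = "length lam" and ?B = "1 + fps_X ^ k :: complex fps"
  let ?H = "\<Prod>s<?l. inverse (linear_factor (x s))"
  have H0: "fps_nth (\<Prod>s<n. inverse (linear_factor (x s))) 0 = 1" for n
    by (induction n) simp_all
  have "jacobi_trudi (?H * ?B) lam = jacobi_trudi ?H lam"
  proof (rule jacobi_trudi_invariant_factor[OF k H0 _ _ petrie])
    show "dilate (root_of_unity k (Suc 0)) ?B = ?B"
      using k by (intro fps_ext) (auto simp: root_of_unity_power)
    show "fps_nth ?B 0 = 1" using k by simp
  qed
  then have "det (mat ?l ?l (\<lambda>(i, r). fps_nth (inverse (linear_factor (x r)) * ?B) (beta_number lam i))) =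
      det (mat ?l ?l (\<lambda>(i, r). fps_nth (inverse (linear_factor (x r)) * 1) (beta_number lam i)))"
    unfolding jacobi_trudi_bialternant[symmetric] by simp
  moreover have "fps_nth (inverse (linear_factor c) * ?B) n = c ^ n + (if k \<le> n then c ^ (n - k) else 0)"
    for c :: complex and n
    by (simp add: inverse_linear_factor distrib_left fps_X_power_mult_right_nth)
  moreover have "fps_nth (inverse (linear_factor c) * 1) n = c ^ n" for c :: complex and n
    by (simp add: inverse_linear_factor)
  ultimately show "det (mat ?l ?l (\<lambda>(i, r). x r ^ beta_number lam i +
        (if k \<le> beta_number lam i then x r ^ (beta_number lam i - k) else 0))) =
      det (mat ?l ?l (\<lambda>(i, r). x r ^ beta_number lam i))"
    by (simp only:)
qed (use k in simp)

section \<open>Ribbons and beta numbers\<close>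

text \<open>Padding by zeros lets diagrams with different numbers of rows be compared row by
  row.\<close>

definition part :: "nat list \<Rightarrow> nat \<Rightarrow> nat" where
  "part lam i = (if i < length lam then lam ! i else 0)"

lemma diagram_part: "diagram lam = {(i, j). j < part lam i}"
  by (auto simp: part_def diagram_def split: if_splits)

lemma part_antimono:
  assumes "is_partition lam" "i \<le> j"
  shows "part lam j \<le> part lam i"
  using assms by (cases "i = j") (auto simp: part_def is_partition_def sorted_wrt_iff_nth_less)

text \<open>The ribbon fills rows \<open>a\<close> to \<open>z\<close>, neighbouring rows sharing
  one column. Subtracting \<open>k\<close> from the beta number of row \<open>a\<close> therefore
  gives that of row \<open>z\<close> of \<open>mu\<close>, padded to \<open>length lam\<close> rows.
  It lies below the beta numbers of \<open>lam\<close> in rows up to \<open>z\<close> and above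
  those in later rows.\<close>

theorem ribbon_beta_number:
  assumes lam: "is_partition lam" and mu: "is_partition mu" and sub: "diagram mu \<subseteq> diagram lam"
    and ribbon: "is_ribbon (diagram lam - diagram mu)"
  defines "k \<equiv> card (diagram lam - diagram mu)"
  obtains i where "i < length lam" "k \<le> beta_number lam i"
    "\<And>j. j < length lam \<Longrightarrow> beta_number lam j \<noteq> beta_number lam i - k"
proof -
  let ?L = "part lam" and ?m = "part mu" and ?S = "diagram lam - diagram mu"
  have S: "?S = {(i, j). ?m i \<le> j \<and> j < ?L i}" by (auto simp: diagram_part)
  have le: "?m i \<le> ?L i" for i
    using sub by (auto simp: diagram_part subset_iff) (meson not_le order.irrefl)
  have Lanti: "?L j \<le> ?L i" and manti: "?m j \<le> ?m i" if "i \<le> j" for i j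
    using part_antimono lam mu that by auto
  define R where "R = {i. ?m i < ?L i}"
  have Rl: "i < length lam" if "i \<in> R" for i
    using that by (auto simp: R_def part_def split: if_splits)
  then have finR: "finite R" by (meson finite_lessThan finite_subset lessThan_iff subsetI)
  have "?S \<noteq> {}" using ribbon by (simp add: is_ribbon_def)
  then obtain i j where "?m i \<le> j" "j < ?L i" unfolding S by auto
  then have "i \<in> R" by (simp add: R_def)
  then have "R \<noteq> {}" by auto
  define a where "a = Min R"
  define z where "z = Max R"
  have a: "a \<in> R" and z: "z \<in> R" using finR \<open>R \<noteq> {}\<close> by (simp_all add: a_def z_def)
  have bounds: "a \<le> i \<and> i \<le> z" if "i \<in> R" for i
    using that finR by (simp add: a_def z_def)
  have step: "?L (Suc i) = Suc (?m i)" if i: "a \<le> i" "i < z" for i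
  proof (rule antisym)
    \<comment> \<open>Two common columns would contain a 2-by-2 square.\<close>
    show "?L (Suc i) \<le> Suc (?m i)"
    proof (rule ccontr)
      assume "\<not> ?L (Suc i) \<le> Suc (?m i)"
      then have "{(i, ?m i), (Suc i, ?m i), (i, Suc (?m i)), (Suc i, Suc (?m i))} \<subseteq> ?S"
        using Lanti[of i "Suc i"] manti[of i "Suc i"] unfolding S by auto
      then show False using ribbon unfolding is_ribbon_def by blast
    qed
    \<comment> \<open>Without a common column no path of adjacent boxes from row \<open>a\<close>
      gets past row \<open>i\<close>.\<close>
    show "Suc (?m i) \<le> ?L (Suc i)"
    proof (rule ccontr)
      assume gap: "\<not> Suc (?m i) \<le> ?L (Suc i)"
      have "((a, ?m a), (z, ?m z)) \<in> (adjacent_in ?S)\<^sup>*"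
        using ribbon a z unfolding is_ribbon_def S R_def by auto
      then have "fst (z, ?m z) \<le> i"
      proof (induction rule: rtrancl_induct)
        case base
        then show ?case using i by simp
      next
        case (step c d)
        have False if "fst c = i" "fst d = Suc i"
          using step(2) that gap unfolding S adjacent_in_def by auto
        then show ?case using step(2,3) unfolding adjacent_in_def by fastforce
      qed
      then show False using i by simp
    qed
  qed
  have "?S = (SIGMA i:{a..z}. {?m i..<?L i})"
    using bounds unfolding S R_def by fastforce
  then have "k = (\<Sum>i=a..z. ?L i - ?m i)" by (simp add: k_def)
  then have k: "int k = (\<Sum>i=a..z. int (?L i) - int (?m i))" using le by (simp add: of_nat_diff)
  \<comment> \<open>By \<open>step\<close> the row lengths telescope, each overlap contributing
    1.\<close>
  have "(\<Sum>i=a..a + d. int (?L i) - int (?m i)) = int (?L a) - int (?m (a + d)) + int d" if "a + d \<le> z" for d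
    using that
  proof (induction d)
    case (Suc d)
    then show ?case using step[of "a + d"] by simp
  qed simp
  from this[of "z - a"] k have "int k = int (?L a) - int (?m z) + int (z - a)"
    using bounds[OF z] by simp
  moreover have "a < length lam" "z < length lam" using Rl a z by auto
  ultimately have ka: "beta_number lam a = k + (?m z + (length lam - Suc z))"
    using bounds[OF z] by (simp add: beta_number_def part_def of_nat_diff)
  have "beta_number lam j \<noteq> beta_number lam a - k" if j: "j < length lam" for j
  proof (cases "j \<le> z")
    case True
    then have "?m z < lam ! j"
      using Lanti[OF True] z j unfolding R_def by (simp add: part_def)
    then show ?thesis using True by (simp add: ka) (simp add: beta_number_def)
  next
    case False
    then have "j \<notin> R" using bounds by auto
    then have "lam ! j \<le> ?m z"
      using le[of j] manti[of z j] False j by (simp add: R_def part_def)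
    then show ?thesis using False j by (simp add: ka) (simp add: beta_number_def)
  qed
  then show ?thesis using that[of a] ka \<open>a < length lam\<close> by simp
qed

theorem theorem6:
  fixes k :: nat and lam :: "nat list" and m :: "nat list \<Rightarrow> int"
  assumes "prime k" and "odd k"
    and "is_partition lam"
    and "modular_schur k lam = (\<Sum>nu\<in>partitions (sum_list lam). of_int (m nu) * schur nu)"
    and "\<forall>nu\<in>partitions (sum_list lam). m nu = (if nu = lam then 1 else 0)"
  shows "is_core k lam"
proof -
  have k: "k > 2"
    using prime_ge_2_nat[OF assms(1)] assms(2) by (cases "k = 2") auto
  have lam: "sorted_wrt (\<ge>) lam" using assms(3) by (simp add: is_partition_def)
  have "lam \<in> partitions (sum_list lam)" using assms(3) by (simp add: partitions_def)
  moreover have "modular_schur k lam = (\<Sum>nu\<in>partitions (sum_list lam). if nu = lam then schur nu else 0)"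
    unfolding assms(4) by (rule sum.cong) (use assms(5) in auto)
  ultimately have "modular_schur k lam = schur lam"
    using finite_partitions by simp
  then have petrie: "jacobi_trudi (petrie_product x N k) lam =
      jacobi_trudi (\<Prod>i<N. inverse (linear_factor (x i :: complex))) lam" for x N
    using k lam by (intro jacobi_trudi_petrie_product) auto
  show ?thesis
    unfolding is_core_def
  proof clarify
    fix mu assume mu: "is_partition mu" "diagram mu \<subseteq> diagram lam"
      "is_ribbon (diagram lam - diagram mu)" "k = card (diagram lam - diagram mu)"
    obtain i where "i < length lam" "k \<le> beta_number lam i"
      "\<And>j. j < length lam \<Longrightarrow> beta_number lam j \<noteq> beta_number lam i - k"
      using ribbon_beta_number[OF assms(3) mu(1,2,3)] mu(4) by metis
    then show False using beta_number_shift[OF k lam petrie] by blast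
  qed
qed

end
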